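(* $[\tau(\mathbf{SemConv})\mathbf{Txt}\mathbf{G}\mathbf{Bc}] = [\mathbf{Txt}\mathbf{G}\mathbf{SemConv}\mathbf{Bc}]$.
   Context: Fix an acceptable numbering $(\varphi_e)$ of partial computable functions, $W_e=\mathrm{dom}(\varphi_e)$. A text is a total function $T:\mathbb N\to\mathbb N\cup\{\#\}$, $\mathrm{content}(T)=\mathrm{range}(T)\setminus\{\#\}$, $T[n]=(T(0),\dots,T(n-1))$; $\mathbf{Txt}$ is the set of all texts, $\mathbf{Txt}(L)$ those with content $L$. Learners are partial computable functions; $\mathbf G(h,T)(i)=h(T[i])$. For total $p:\mathbb N\to\mathbb N$ and text $T$: $\mathbf{Bc}(p,T)$ iff $\exists n_0\,\forall n\ge n_0: W_{p(n)}=\mathrm{content}(T)$; $\mathbf{SemConv}(p,T)$ iff for all $n<m$ with $\mathrm{content}(T[m])\subseteq W_{p(n)}$ we have $W_{p(n)}=W_{p(m)}$. A learner $h$ $\tau(\alpha)\mathbf{Txt}\mathbf G\delta\mathbf{Bc}$-learns $L$ iff for every $T\in\mathbf{Txt}$, $\mathbf G(h,T)$ is total and $\alpha(\mathbf G(h,T),T)$ holds, and for every $T\in\mathbf{Txt}(L)$, $\delta(\mathbf G(h,T),T)\wedge\mathbf{Bc}(\mathbf G(h,T),T)$ holds; omitting $\tau(\alpha)$ drops the global requirement; omitting $\delta$ means no restriction. $[\cdot]$ is the set of classes learnable by a single learner under the criterion. *)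

theory Defs
  imports Main "HOL-Library.Nat_Bijection"
begin

datatype recf = Z | S | Id nat | Cn recf "recf list" | Pr recf recf | Mn recf

inductive eval :: "recf \<Rightarrow> nat list \<Rightarrow> nat \<Rightarrow> bool" where
  eval_Z: "eval Z xs 0"
| eval_S: "eval S (x # xs) (Suc x)"
| eval_Id: "n < length xs \<Longrightarrow> eval (Id n) xs (xs ! n)"
| eval_Cn: "list_all2 (\<lambda>g z. eval g xs z) gs zs \<Longrightarrow> eval f zs y \<Longrightarrow> eval (Cn f gs) xs y"
| eval_Pr0: "eval f xs y \<Longrightarrow> eval (Pr f g) (0 # xs) y"
| eval_PrS: "eval (Pr f g) (n # xs) z \<Longrightarrow> eval g (n # z # xs) y \<Longrightarrow> eval (Pr f g) (Suc n # xs) y"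
| eval_Mn: "eval f (z # xs) 0 \<Longrightarrow> (\<forall>w<z. \<exists>v. eval f (w # xs) v \<and> v \<noteq> 0) \<Longrightarrow> eval (Mn f) xs z"

definition pcomp1 :: "(nat \<Rightarrow> nat option) \<Rightarrow> bool" where
  "pcomp1 g \<longleftrightarrow> (\<exists>f. \<forall>x y. g x = Some y \<longleftrightarrow> eval f [x] y)"

definition pcomp2 :: "(nat \<Rightarrow> nat \<Rightarrow> nat option) \<Rightarrow> bool" where
  "pcomp2 g \<longleftrightarrow> (\<exists>f. \<forall>x1 x2 y. g x1 x2 = Some y \<longleftrightarrow> eval f [x1, x2] y)"

definition total_comp :: "(nat \<Rightarrow> nat) \<Rightarrow> bool" where
  "total_comp t \<longleftrightarrow> pcomp1 (\<lambda>x. Some (t x))"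

definition acceptable :: "(nat \<Rightarrow> nat \<Rightarrow> nat option) \<Rightarrow> bool" where
  "acceptable \<phi> \<longleftrightarrow> pcomp2 \<phi> \<and>
     (\<forall>\<theta>. pcomp2 \<theta> \<longrightarrow> (\<exists>t. total_comp t \<and> (\<forall>e. \<theta> e = \<phi> (t e))))"

definition W :: "(nat \<Rightarrow> nat \<Rightarrow> nat option) \<Rightarrow> nat \<Rightarrow> nat set" where
  "W \<phi> e = {x. \<phi> e x \<noteq> None}"

text \<open>A text is a total function into nat option; None plays the role of the pause symbol #.\<close>
type_synonym ntext = "nat \<Rightarrow> nat option"

definition content :: "ntext \<Rightarrow> nat set" where
  "content T = {x. \<exists>i. T i = Some x}"

definition init_seg :: "ntext \<Rightarrow> nat \<Rightarrow> nat option list" where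
  "init_seg T n = map T [0..<n]"

definition content_seq :: "nat option list \<Rightarrow> nat set" where
  "content_seq \<sigma> = {x. Some x \<in> set \<sigma>}"

definition seq_code :: "nat option list \<Rightarrow> nat" where
  "seq_code \<sigma> = list_encode (map (case_option 0 Suc) \<sigma>)"

definition G :: "(nat \<Rightarrow> nat option) \<Rightarrow> ntext \<Rightarrow> nat \<Rightarrow> nat option" where
  "G h T i = h (seq_code (init_seg T i))"

definition G_total :: "(nat \<Rightarrow> nat option) \<Rightarrow> ntext \<Rightarrow> bool" where
  "G_total h T \<longleftrightarrow> (\<forall>i. G h T i \<noteq> None)"

definition Gp :: "(nat \<Rightarrow> nat option) \<Rightarrow> ntext \<Rightarrow> nat \<Rightarrow> nat" where
  "Gp h T i = the (G h T i)"

definition Bc :: "(nat \<Rightarrow> nat \<Rightarrow> nat option) \<Rightarrow> (nat \<Rightarrow> nat) \<Rightarrow> ntext \<Rightarrow> bool" where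
  "Bc \<phi> p T \<longleftrightarrow> (\<exists>n0. \<forall>n\<ge>n0. W \<phi> (p n) = content T)"

definition SemConv :: "(nat \<Rightarrow> nat \<Rightarrow> nat option) \<Rightarrow> (nat \<Rightarrow> nat) \<Rightarrow> ntext \<Rightarrow> bool" where
  "SemConv \<phi> p T \<longleftrightarrow> (\<forall>n m. n < m \<and> content_seq (init_seg T m) \<subseteq> W \<phi> (p n)
       \<longrightarrow> W \<phi> (p n) = W \<phi> (p m))"

definition learns_tauSemConv_Bc :: "(nat \<Rightarrow> nat \<Rightarrow> nat option) \<Rightarrow> (nat \<Rightarrow> nat option) \<Rightarrow> nat set set \<Rightarrow> bool" where
  "learns_tauSemConv_Bc \<phi> h \<L> \<longleftrightarrow>
     (\<forall>T. G_total h T \<and> SemConv \<phi> (Gp h T) T) \<and>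
     (\<forall>L\<in>\<L>. \<forall>T. content T = L \<longrightarrow> Bc \<phi> (Gp h T) T)"

definition learns_SemConv_Bc :: "(nat \<Rightarrow> nat \<Rightarrow> nat option) \<Rightarrow> (nat \<Rightarrow> nat option) \<Rightarrow> nat set set \<Rightarrow> bool" where
  "learns_SemConv_Bc \<phi> h \<L> \<longleftrightarrow>
     (\<forall>L\<in>\<L>. \<forall>T. content T = L \<longrightarrow>
        G_total h T \<and> SemConv \<phi> (Gp h T) T \<and> Bc \<phi> (Gp h T) T)"

definition TauSemConvTxtGBc :: "(nat \<Rightarrow> nat \<Rightarrow> nat option) \<Rightarrow> nat set set set" where
  "TauSemConvTxtGBc \<phi> = {\<L>. \<exists>h. pcomp1 h \<and> learns_tauSemConv_Bc \<phi> h \<L>}"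

definition TxtGSemConvBc :: "(nat \<Rightarrow> nat \<Rightarrow> nat option) \<Rightarrow> nat set set set" where
  "TxtGSemConvBc \<phi> = {\<L>. \<exists>h. pcomp1 h \<and> learns_SemConv_Bc \<phi> h \<L>}"

end

theory Submission
  imports Defs "HOL-Library.Sublist"
begin

text \<open>Given a learner, let \<open>w(\<sigma>)\<close> be the set it conjectures on \<open>\<sigma>\<close>. The new learner conjectures a set that
  is enumerated jointly for all sequences, by stages. Each \<open>\<sigma>\<close> owns a granted set and a finite requested
  set, both initially the content of \<open>\<sigma>\<close>. A sequence is frozen once the request of a proper prefix
  contains its content. When an unfrozen \<open>\<sigma>\<close> finds its request inside \<open>w(\<sigma>)\<close>, the request is granted,
  and \<open>\<sigma>\<close> issues a larger one, containing the part of \<open>w(\<sigma>)\<close> found so far and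
  closed under absorbing the requests of all extensions whose content it contains. Such extensions do not
  change while the request is pending, so granting it never contradicts what they have enumerated: a
  sequence may adopt the granted set of any prefix that covers its content, and this makes the conjectures
  conservative on every text.

  On a text for a learnt language \<open>L\<close> no granted set of a prefix properly extends \<open>L\<close>, since a semantically conservative
  learner never overgeneralises; this settles finite \<open>L\<close>. If \<open>L\<close> is infinite, the finitely many prefixes
  with \<open>w(\<sigma>) \<noteq> L\<close> can freeze only finitely many prefixes of the text: a request that is never granted is
  finite, and one that is granted remains inside \<open>w(\<sigma>)\<close>, which does not contain \<open>L\<close>. From then on the
  shortest prefix whose request covers the current content is never frozen, its requests stay
  inside \<open>L\<close>, and so its granted set grows to \<open>L\<close>.\<close>

section \<open>Total recursive functions\<close>

lemma eval_Z_iff: "eval Z xs y \<longleftrightarrow> y = 0"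
  by (auto intro: eval.intros elim: eval.cases)

lemma eval_S_iff: "eval S xs y \<longleftrightarrow> (\<exists>x zs. xs = x # zs \<and> y = Suc x)"
  by (auto intro: eval.intros elim: eval.cases)

lemma eval_Id_iff: "eval (Id n) xs y \<longleftrightarrow> n < length xs \<and> y = xs ! n"
  by (auto intro: eval.intros elim: eval.cases)

lemma eval_Cn_iff:
  "eval (Cn f gs) xs y \<longleftrightarrow> (\<exists>zs. list_all2 (\<lambda>g z. eval g xs z) gs zs \<and> eval f zs y)"
  by (auto intro: eval.intros elim: eval.cases)

lemma eval_Pr_0_iff: "eval (Pr f g) (0 # xs) y \<longleftrightarrow> eval f xs y"
  by (auto intro: eval.intros elim: eval.cases)

lemma eval_Pr_Suc_iff:
  "eval (Pr f g) (Suc n # xs) y \<longleftrightarrow> (\<exists>z. eval (Pr f g) (n # xs) z \<and> eval g (n # z # xs) y)"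
  by (auto intro: eval.intros elim: eval.cases)

lemma eval_Mn_iff:
  "eval (Mn f) xs z \<longleftrightarrow> eval f (z # xs) 0 \<and> (\<forall>w<z. \<exists>v. eval f (w # xs) v \<and> v \<noteq> 0)"
  by (auto intro: eval.intros elim: eval.cases)

text \<open>Programs carry no arity, so an \<open>n\<close>-ary function is given on all lists and
  constrained only on those of length \<open>n\<close>.\<close>

definition rec_total :: "nat \<Rightarrow> (nat list \<Rightarrow> nat) \<Rightarrow> bool" where
  "rec_total n F \<longleftrightarrow> (\<exists>f. \<forall>xs. length xs = n \<longrightarrow> (\<forall>y. eval f xs y \<longleftrightarrow> y = F xs))"

lemma rec_total_cong:
  assumes "rec_total n F" "\<And>xs. length xs = n \<Longrightarrow> F xs = H xs"
  shows "rec_total n H"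
  using assms unfolding rec_total_def by metis

lemma rec_total_proj: "i < n \<Longrightarrow> rec_total n (\<lambda>xs. xs ! i)"
  unfolding rec_total_def by (rule exI[of _ "Id i"]) (auto simp: eval_Id_iff)

lemma rec_total_comp:
  assumes F: "rec_total (length Hs) F" and Hs: "\<forall>H\<in>set Hs. rec_total n H"
  shows "rec_total n (\<lambda>xs. F (map (\<lambda>H. H xs) Hs))"
proof -
  from F obtain f where f: "\<And>xs y. length xs = length Hs \<Longrightarrow> eval f xs y \<longleftrightarrow> y = F xs"
    unfolding rec_total_def by blast
  from Hs have "\<exists>gs. list_all2 (\<lambda>g H. \<forall>xs. length xs = n \<longrightarrow> (\<forall>y. eval g xs y \<longleftrightarrow> y = H xs)) gs Hs"
  proof (induction Hs)
    case (Cons H Hs)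
    then obtain gs where
      gs: "list_all2 (\<lambda>g H. \<forall>xs. length xs = n \<longrightarrow> (\<forall>y. eval g xs y \<longleftrightarrow> y = H xs)) gs Hs"
      by auto
    obtain g where "\<forall>xs. length xs = n \<longrightarrow> (\<forall>y. eval g xs y \<longleftrightarrow> y = H xs)"
      using Cons.prems unfolding rec_total_def by auto
    with gs show ?case by (intro exI[of _ "g # gs"]) simp
  qed simp
  then obtain gs where
    gs: "list_all2 (\<lambda>g H. \<forall>xs. length xs = n \<longrightarrow> (\<forall>y. eval g xs y \<longleftrightarrow> y = H xs)) gs Hs" ..
  \<comment> \<open>Each program in \<open>gs\<close> has exactly one value on \<open>xs\<close>, so
    the list of intermediate values is forced.\<close>
  have "list_all2 (\<lambda>g z. eval g xs z) gs zs \<longleftrightarrow> zs = map (\<lambda>H. H xs) Hs"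
    if "length xs = n" for xs zs
    using gs
  proof (induction gs Hs arbitrary: zs rule: list_all2_induct)
    case (Cons g gs H Hs)
    then show ?case using that by (cases zs) auto
  qed auto
  then show ?thesis
    unfolding rec_total_def by (intro exI[of _ "Cn f gs"]) (auto simp: eval_Cn_iff f)
qed

text \<open>Adds \<open>k\<close> dummy arguments in front by composing \<open>F\<close> with the
  projections to the remaining positions.\<close>

lemma rec_total_drop:
  assumes "rec_total n F"
  shows "rec_total (k + n) (\<lambda>ys. F (drop k ys))"
proof -
  have "rec_total (k + n) (\<lambda>xs. F (map (\<lambda>H. H xs) (map (\<lambda>i xs. xs ! (k + i)) [0..<n])))"
    by (rule rec_total_comp) (use assms in \<open>auto intro: rec_total_proj\<close>)
  then show ?thesis
  proof (rule rec_total_cong)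
    fix xs :: "nat list" assume "length xs = k + n"
    then have "map (\<lambda>H. H xs) (map (\<lambda>i xs. xs ! (k + i)) [0..<n]) = drop k xs"
      by (intro nth_equalityI) auto
    then show "F (map (\<lambda>H. H xs) (map (\<lambda>i xs. xs ! (k + i)) [0..<n])) = F (drop k xs)" by simp
  qed
qed

lemma rec_total_Suc: "rec_total n F \<Longrightarrow> rec_total n (\<lambda>xs. Suc (F xs))"
proof -
  assume F: "rec_total n F"
  have "rec_total (length [F]) (\<lambda>xs. Suc (xs ! 0))"
    unfolding rec_total_def by (rule exI[of _ S]) (auto simp: eval_S_iff length_Suc_conv)
  from rec_total_comp[OF this, of n] F show ?thesis by simp
qed

lemma rec_total_const: "rec_total n (\<lambda>xs. c)"
proof (induction c)
  case 0
  then show ?case unfolding rec_total_def by (rule exI[of _ Z]) (simp add: eval_Z_iff)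
qed (rule rec_total_Suc)

text \<open>\<open>B\<close> receives the counter and the previous value ahead of the parameters, as
  \<open>Pr\<close> passes them; the curried \<open>b\<close> lets the result be read as an ordinary
  \<open>rec_nat\<close>. Since \<open>Pr\<close> recurses on its first argument, it is finally
  composed with \<open>N\<close> and the projections.\<close>

lemma rec_total_rec_nat:
  assumes A: "rec_total n A" and B: "rec_total (Suc (Suc n)) B" and N: "rec_total n N"
    and b: "\<And>xs m r. length xs = n \<Longrightarrow> B (m # r # xs) = b xs m r"
  shows "rec_total n (\<lambda>xs. rec_nat (A xs) (b xs) (N xs))"
proof -
  obtain f where f: "\<And>xs y. length xs = n \<Longrightarrow> eval f xs y \<longleftrightarrow> y = A xs"
    using A unfolding rec_total_def by blast
  obtain g where g: "\<And>xs y. length xs = Suc (Suc n) \<Longrightarrow> eval g xs y \<longleftrightarrow> y = B xs"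
    using B unfolding rec_total_def by blast
  have "eval (Pr f g) (m # xs) y \<longleftrightarrow> y = rec_nat (A xs) (b xs) m" if "length xs = n" for m xs y
    using that
    by (induction m arbitrary: y) (auto simp: eval_Pr_0_iff eval_Pr_Suc_iff f g b)
  then have "rec_total (Suc n) (\<lambda>ys. rec_nat (A (tl ys)) (b (tl ys)) (hd ys))"
    unfolding rec_total_def by (intro exI[of _ "Pr f g"]) (auto simp: length_Suc_conv)
  moreover have "\<forall>H\<in>set (N # map (\<lambda>i xs. xs ! i) [0..<n]). rec_total n H"
    using N by (auto intro: rec_total_proj)
  ultimately have "rec_total n (\<lambda>xs. (\<lambda>ys. rec_nat (A (tl ys)) (b (tl ys)) (hd ys))
      (map (\<lambda>H. H xs) (N # map (\<lambda>i xs. xs ! i) [0..<n])))"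
    by (intro rec_total_comp) auto
  then show ?thesis
  proof (rule rec_total_cong)
    fix xs :: "nat list" assume "length xs = n"
    then have "map (\<lambda>H. H xs) (map (\<lambda>i xs. xs ! i) [0..<n]) = xs"
      by (intro nth_equalityI) auto
    then show "(\<lambda>ys. rec_nat (A (tl ys)) (b (tl ys)) (hd ys))
      (map (\<lambda>H. H xs) (N # map (\<lambda>i xs. xs ! i) [0..<n])) = rec_nat (A xs) (b xs) (N xs)" by simp
  qed
qed

lemma rec_total_hd: "rec_total (Suc n) hd"
  by (rule rec_total_cong[OF rec_total_proj[of 0]]) (auto simp: length_Suc_conv)

lemma rec_total_second: "rec_total (Suc (Suc n)) (\<lambda>ys. ys ! Suc 0)"
  by (rule rec_total_proj) simp

text \<open>A case distinction is a primitive recursion that ignores the previous value.\<close>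

lemma rec_total_case_nat:
  assumes A: "rec_total n A" and B: "rec_total (Suc n) B" and N: "rec_total n N"
    and b: "\<And>xs m. length xs = n \<Longrightarrow> B (m # xs) = b xs m"
  shows "rec_total n (\<lambda>xs. case N xs of 0 \<Rightarrow> A xs | Suc m \<Rightarrow> b xs m)"
proof -
  \<comment> \<open>The index map skips position 1, so it turns \<open>m # r # xs\<close> into
    \<open>m # xs\<close> and hides the previous value \<open>r\<close> from
    \<open>B\<close>.\<close>
  have "rec_total (length (map (\<lambda>i (ys::nat list). ys ! (if i = 0 then 0 else Suc i)) [0..<Suc n])) B"
    using B by simp
  then have "rec_total (Suc (Suc n))
    (\<lambda>xs. B (map (\<lambda>H. H xs) (map (\<lambda>i ys. ys ! (if i = 0 then 0 else Suc i)) [0..<Suc n])))"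
    by (rule rec_total_comp) (auto intro!: rec_total_proj simp del: upt_Suc)
  then have "rec_total (Suc (Suc n)) (\<lambda>ys. B (hd ys # drop 2 ys))"
  proof (rule rec_total_cong)
    fix xs :: "nat list" assume "length xs = Suc (Suc n)"
    then have "map (\<lambda>H. H xs) (map (\<lambda>i ys. ys ! (if i = 0 then 0 else Suc i)) [0..<Suc n])
      = hd xs # drop 2 xs"
      by (intro nth_equalityI) (auto simp: nth_Cons' length_Suc_conv simp del: upt_Suc)
    then show "B (map (\<lambda>H. H xs) (map (\<lambda>i ys. ys ! (if i = 0 then 0 else Suc i)) [0..<Suc n]))
      = B (hd xs # drop 2 xs)" by simp
  qed
  from rec_total_rec_nat[OF A this N, of "\<lambda>xs m r. b xs m"]
  have "rec_total n (\<lambda>xs. rec_nat (A xs) (\<lambda>m r. b xs m) (N xs))"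
    by (simp add: b numeral_2_eq_2)
  then show ?thesis by (rule rec_total_cong) (simp split: nat.split)
qed

lemma rec_total_if0:
  assumes "rec_total n C" "rec_total n A" "rec_total n B"
  shows "rec_total n (\<lambda>xs. if C xs = 0 then A xs else B xs)"
proof -
  have "rec_total n (\<lambda>xs. case C xs of 0 \<Rightarrow> A xs | Suc m \<Rightarrow> B xs)"
    using rec_total_case_nat[OF assms(2) rec_total_drop[OF assms(3), of 1, simplified] assms(1)]
    by simp
  then show ?thesis by (rule rec_total_cong) (simp split: nat.split)
qed

lemma rec_total_add:
  assumes "rec_total n F" "rec_total n H"
  shows "rec_total n (\<lambda>xs. F xs + H xs)"
proof -
  have "rec_nat a (\<lambda>_. Suc) m = a + m" for a m by (induction m) auto
  with rec_total_rec_nat[OF assms(1) rec_total_Suc[OF rec_total_second] assms(2), of "\<lambda>xs m r. Suc r"]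
  show ?thesis by simp
qed

lemma rec_total_diff:
  assumes "rec_total n F" "rec_total n H"
  shows "rec_total n (\<lambda>xs. F xs - H xs)"
proof -
  have pred: "rec_total n (\<lambda>xs. N xs - 1)" if "rec_total n N" for N n
    by (rule rec_total_cong, rule rec_total_case_nat[OF rec_total_const[of n 0] rec_total_hd that])
      (auto split: nat.split)
  have "rec_nat a (\<lambda>_ r. r - Suc 0) m = a - m" for a m by (induction m) auto
  with rec_total_rec_nat[OF assms(1) pred[OF rec_total_second] assms(2), of "\<lambda>xs m r. r - 1"]
  show ?thesis by simp
qed

section \<open>Cantor's pairing function and its inverse\<close>

lemma rec_total_triangle:
  assumes "rec_total n F"
  shows "rec_total n (\<lambda>xs. triangle (F xs))"
proof -
  have "rec_nat 0 (\<lambda>m r. r + Suc m) m = triangle m" for m by (induction m) auto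
  moreover have "rec_total n (\<lambda>xs. rec_nat 0 (\<lambda>m r. r + Suc m) (F xs))"
    by (rule rec_total_rec_nat[OF rec_total_const
          rec_total_add[OF rec_total_second rec_total_Suc[OF rec_total_hd]] assms]) simp
  ultimately show ?thesis by simp
qed

lemma rec_total_prod_encode:
  assumes "rec_total n F" "rec_total n H"
  shows "rec_total n (\<lambda>xs. prod_encode (F xs, H xs))"
  unfolding prod_encode_def prod.case using assms by (intro rec_total_add rec_total_triangle)

text \<open>The index of the diagonal on which \<open>n\<close> lies, i.e. the inverse of
  \<open>triangle\<close> rounded down. The recursion raises it whenever the next triangular number
  is reached; the truncated difference vanishes exactly if
  \<open>triangle (Suc r) \<le> Suc m\<close>.\<close>

definition diagonal :: "nat \<Rightarrow> nat" where
  "diagonal n = rec_nat 0 (\<lambda>m r. if triangle (Suc r) - Suc m = 0 then Suc r else r) n"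

lemma diagonal_bounds: "triangle (diagonal n) \<le> n \<and> n < triangle (Suc (diagonal n))"
proof (induction n)
  case (Suc n)
  have "diagonal (Suc n) = (if triangle (Suc (diagonal n)) \<le> Suc n then Suc (diagonal n) else diagonal n)"
    by (simp add: diagonal_def)
  with Suc show ?case by (auto simp del: triangle_Suc) simp_all
qed (simp add: diagonal_def)

text \<open>The code of \<open>(a, b)\<close> is \<open>triangle (a + b) + a\<close>, which lies
  below \<open>triangle (Suc (a + b))\<close>; monotonicity of \<open>triangle\<close> excludes
  every other diagonal.\<close>

lemma diagonal_prod_encode: "diagonal (prod_encode (a, b)) = a + b"
proof -
  have mono: "triangle i \<le> triangle j" if "i \<le> j" for i j
    using that by (induction rule: dec_induct) auto
  let ?d = "diagonal (prod_encode (a, b))"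
  have *: "triangle (a + b) \<le> prod_encode (a, b)" "prod_encode (a, b) < triangle (Suc (a + b))"
    by (auto simp: prod_encode_def)
  have "\<not> Suc (a + b) \<le> ?d" using mono[of "Suc (a + b)" ?d] diagonal_bounds[of "prod_encode (a, b)"] *
    by linarith
  moreover have "\<not> Suc ?d \<le> a + b" using mono[of "Suc ?d" "a + b"] diagonal_bounds[of "prod_encode (a, b)"] *
    by linarith
  ultimately show ?thesis by linarith
qed

lemma rec_total_prod_decode:
  assumes "rec_total n F"
  shows "rec_total n (\<lambda>xs. fst (prod_decode (F xs)))" "rec_total n (\<lambda>xs. snd (prod_decode (F xs)))"
proof -
  have D: "rec_total n (\<lambda>xs. diagonal (F xs))"
    unfolding diagonal_def
    by (rule rec_total_rec_nat[OF rec_total_const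
          rec_total_if0[OF rec_total_diff[OF rec_total_triangle[OF rec_total_Suc[OF rec_total_second]]
            rec_total_Suc[OF rec_total_hd]] rec_total_Suc[OF rec_total_second] rec_total_second] assms]) simp
  \<comment> \<open>The first component is the offset of \<open>k\<close> on its diagonal, and the
    index of the diagonal is the sum of both components.\<close>
  have fst_eq: "fst (prod_decode k) = k - triangle (diagonal k)"
    and snd_eq: "snd (prod_decode k) = diagonal k - fst (prod_decode k)" for k
    using diagonal_prod_encode[of "fst (prod_decode k)" "snd (prod_decode k)"]
      prod_decode_inverse[of k] by (auto simp: prod_encode_def case_prod_beta)
  show 1: "rec_total n (\<lambda>xs. fst (prod_decode (F xs)))"
    unfolding fst_eq using assms D by (intro rec_total_diff rec_total_triangle)
  show "rec_total n (\<lambda>xs. snd (prod_decode (F xs)))"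
    unfolding snd_eq using D 1 by (intro rec_total_diff)
qed

lemma rec_total_imp_total_comp:
  assumes "rec_total 1 F"
  shows "total_comp (\<lambda>x. F [x])"
proof -
  obtain f where "\<And>xs y. length xs = 1 \<Longrightarrow> eval f xs y \<longleftrightarrow> y = F xs"
    using assms unfolding rec_total_def by blast
  then show ?thesis unfolding total_comp_def pcomp1_def by (intro exI[of _ f]) auto
qed

lemma rec_total_total_comp:
  assumes "total_comp t" "rec_total n F"
  shows "rec_total n (\<lambda>xs. t (F xs))"
proof -
  obtain f where "\<And>x y. eval f [x] y \<longleftrightarrow> y = t x"
    using assms unfolding total_comp_def pcomp1_def option.inject by metis
  then have "rec_total (length [F]) (\<lambda>xs. t (xs ! 0))"
    unfolding rec_total_def by (intro exI[of _ f]) (auto simp: length_Suc_conv)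
  from rec_total_comp[OF this, of n] assms(2) show ?thesis by simp
qed

section \<open>Computable functions on encoded data\<close>

class encodable =
  fixes enc :: "'a \<Rightarrow> nat"
  assumes inj_enc: "inj enc"

lemma enc_eq_iff [simp]: "enc x = enc y \<longleftrightarrow> x = y"
  using inj_enc by (auto dest: injD)

instantiation nat :: encodable
begin
definition enc_nat :: "nat \<Rightarrow> nat" where [simp]: "enc_nat n = n"
instance by standard (simp add: inj_def)
end

instantiation bool :: encodable
begin
definition enc_bool :: "bool \<Rightarrow> nat" where [simp]: "enc_bool b = (if b then 1 else 0)"
instance by standard (simp add: inj_def)
end

instantiation prod :: (encodable, encodable) encodable
begin
definition enc_prod :: "'a \<times> 'b \<Rightarrow> nat" where
  [simp]: "enc_prod p = prod_encode (enc (fst p), enc (snd p))"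
instance by standard (simp add: inj_def prod_eq_iff)
end

instantiation option :: (encodable) encodable
begin
definition enc_option :: "'a option \<Rightarrow> nat" where
  [simp]: "enc_option z = (case z of None \<Rightarrow> 0 | Some x \<Rightarrow> Suc (enc x))"
instance by standard (simp add: inj_def split: option.split)
end

instantiation list :: (encodable) encodable
begin
definition enc_list :: "'a list \<Rightarrow> nat" where
  "enc_list xs = list_encode (map enc xs)"
instance by standard (simp add: inj_def enc_list_def inj_map_eq_map[OF inj_enc] list_encode_eq)
end

lemma enc_Nil [simp]: "enc [] = 0"
  and enc_Cons [simp]: "enc (x # xs) = Suc (prod_encode (enc x, enc xs))"
  by (simp_all add: enc_list_def)

text \<open>The realising function is arbitrary on numbers that are not codes.\<close>

definition computable :: "('a::encodable \<Rightarrow> 'b::encodable) \<Rightarrow> bool" where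
  "computable f \<longleftrightarrow> (\<exists>t. total_comp t \<and> (\<forall>x. enc (f x) = t (enc x)))"

named_theorems computable_intros

lemma computableI:
  assumes "rec_total 1 F" "\<And>x. enc (f x) = F [enc x]"
  shows "computable f"
  unfolding computable_def using rec_total_imp_total_comp[OF assms(1)] assms(2) by blast

text \<open>Packs the realiser with its closure property, so that it can be placed inside any
  \<open>rec_total\<close> expression.\<close>

lemma computableD:
  assumes "computable f"
  shows "\<exists>t. (\<forall>x. enc (f x) = t (enc x)) \<and>
    (\<forall>n F. rec_total n F \<longrightarrow> rec_total n (\<lambda>xs. t (F xs)))"
  using assms rec_total_total_comp unfolding computable_def by blast

lemma computable_id [computable_intros]: "computable (\<lambda>x. x)"
  by (rule computableI[of hd]) (auto simp: rec_total_hd[of 0, simplified])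

lemma computable_const [computable_intros]: "computable (\<lambda>x. c)"
  by (rule computableI[OF rec_total_const]) simp

lemma rec_total_hd1: "rec_total 1 hd"
  using rec_total_hd[of 0] by simp

lemma computable_comp:
  assumes "computable f" "computable g"
  shows "computable (\<lambda>x. f (g x))"
proof -
  obtain t where t: "\<And>x. enc (f x) = t (enc x)" 
      "\<And>n F. rec_total n F \<Longrightarrow> rec_total n (\<lambda>xs. t (F xs))"
    using computableD[OF assms(1)] by blast
  obtain u where u: "\<And>x. enc (g x) = u (enc x)"
      "\<And>n F. rec_total n F \<Longrightarrow> rec_total n (\<lambda>xs. u (F xs))"
    using computableD[OF assms(2)] by blast
  show ?thesis by (rule computableI[OF t(2)[OF u(2)[OF rec_total_hd1]]]) (simp add: t u)
qed

lemma computable_Pair [computable_intros]: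
  assumes "computable f" "computable g"
  shows "computable (\<lambda>x. (f x, g x))"
proof -
  obtain t where t: "\<And>x. enc (f x) = t (enc x)" 
      "\<And>n F. rec_total n F \<Longrightarrow> rec_total n (\<lambda>xs. t (F xs))"
    using computableD[OF assms(1)] by blast
  obtain u where u: "\<And>x. enc (g x) = u (enc x)"
      "\<And>n F. rec_total n F \<Longrightarrow> rec_total n (\<lambda>xs. u (F xs))"
    using computableD[OF assms(2)] by blast
  show ?thesis
    by (rule computableI[OF rec_total_prod_encode[OF t(2)[OF rec_total_hd1] u(2)[OF rec_total_hd1]]])
      (simp add: t u)
qed

text \<open>Functions of several arguments are treated as functions on tuples. This rule and the
  next substitute computable arguments, which is how assumptions about such functions are used under
  binders below.\<close>

lemma computable_comp2:
  assumes "computable (\<lambda>p. f (fst p) (snd p))" "computable g" "computable h"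
  shows "computable (\<lambda>x. f (g x) (h x))"
  using computable_comp[OF assms(1) computable_Pair[OF assms(2,3)]] by simp

lemma computable_comp3:
  assumes "computable (\<lambda>p. f (fst p) (fst (snd p)) (snd (snd p)))"
    and "computable g" "computable h" "computable k"
  shows "computable (\<lambda>x. f (g x) (h x) (k x))"
  using computable_comp[OF assms(1) computable_Pair[OF assms(2) computable_Pair[OF assms(3,4)]]] by simp

lemma computable_fst [computable_intros]:
  assumes "computable f"
  shows "computable (\<lambda>x. fst (f x))"
proof -
  have "computable (fst :: 'b \<times> 'c \<Rightarrow> 'b)"
    by (rule computableI[OF rec_total_prod_decode(1)[OF rec_total_hd1]]) simp
  from computable_comp[OF this assms] show ?thesis .
qed

lemma computable_snd [computable_intros]:
  assumes "computable f"
  shows "computable (\<lambda>x. snd (f x))"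
proof -
  have "computable (snd :: 'b \<times> 'c \<Rightarrow> 'c)"
    by (rule computableI[OF rec_total_prod_decode(2)[OF rec_total_hd1]]) simp
  from computable_comp[OF this assms] show ?thesis .
qed

lemma computable_enc [computable_intros]:
  assumes "computable f"
  shows "computable (\<lambda>x. enc (f x))"
proof -
  have "computable (enc :: 'b \<Rightarrow> nat)"
    by (rule computableI[OF rec_total_hd1]) simp
  from computable_comp[OF this assms] show ?thesis .
qed

lemma computable_Suc [computable_intros]:
  assumes "computable f"
  shows "computable (\<lambda>x. Suc (f x))"
proof -
  have "computable Suc"
    by (rule computableI[OF rec_total_Suc[OF rec_total_hd1]]) simp
  from computable_comp[OF this assms] show ?thesis .
qed

lemma computable_Some [computable_intros]:
  assumes "computable f"
  shows "computable (\<lambda>x. Some (f x))"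
proof -
  have "computable (Some :: 'b \<Rightarrow> 'b option)"
    by (rule computableI[OF rec_total_Suc[OF rec_total_hd1]]) simp
  from computable_comp[OF this assms] show ?thesis .
qed

lemma computable_Cons [computable_intros]:
  assumes "computable f" "computable g"
  shows "computable (\<lambda>x. f x # g x)"
proof -
  have "computable (\<lambda>p :: 'b \<times> 'b list. fst p # snd p)"
    by (rule computableI[OF rec_total_Suc[OF rec_total_hd1]]) simp
  from computable_comp[OF this computable_Pair[OF assms]] show ?thesis by simp
qed

text \<open>Codes of truth values, lists and options are 0 or the successor of the code of the constructor's arguments,
  so one case distinction on codes serves all data types.\<close>
lemma computable_case_code:
  fixes f :: "'a::encodable \<Rightarrow> 'b::encodable" and c :: "'a \<Rightarrow> 'c::encodable"
    and b :: "'a \<times> 'd::encodable \<Rightarrow> 'b"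
  assumes a: "computable a" and b: "computable b" and c: "computable c"
    and z: "\<And>x. enc (c x) = 0 \<Longrightarrow> f x = a x"
    and s: "\<And>x m. enc (c x) = Suc m \<Longrightarrow> \<exists>y. m = enc y \<and> f x = b (x, y)"
  shows "computable f"
proof -
  obtain t where t: "\<And>x. enc (a x) = t (enc x)" 
      "\<And>n F. rec_total n F \<Longrightarrow> rec_total n (\<lambda>xs. t (F xs))"
    using computableD[OF a] by blast
  obtain u where u: "\<And>x. enc (b x) = u (enc x)"
      "\<And>n F. rec_total n F \<Longrightarrow> rec_total n (\<lambda>xs. u (F xs))"
    using computableD[OF b] by blast
  obtain v where v: "\<And>x. enc (c x) = v (enc x)"
      "\<And>n F. rec_total n F \<Longrightarrow> rec_total n (\<lambda>xs. v (F xs))"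
    using computableD[OF c] by blast
  have "rec_total 2 (\<lambda>xs. u (prod_encode (xs ! 1, xs ! 0)))"
    by (intro u(2) rec_total_prod_encode rec_total_proj) auto
  then have "rec_total 1 (\<lambda>xs. case v (hd xs) of 0 \<Rightarrow> t (hd xs) | Suc m \<Rightarrow> u (prod_encode (hd xs, m)))"
    by (intro rec_total_case_nat[OF t(2)[OF rec_total_hd1] _ v(2)[OF rec_total_hd1]])
      (auto simp: numeral_2_eq_2 length_Suc_conv)
  then show ?thesis
  proof (rule computableI)
    fix x
    show "enc (f x) = (case v (hd [enc x]) of 0 \<Rightarrow> t (hd [enc x]) | Suc m \<Rightarrow> u (prod_encode (hd [enc x], m)))"
      using z[of x] s[of x] by (auto simp: v t split: nat.split) (metis enc_prod_def fst_conv snd_conv u(1))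
  qed
qed

lemma computable_case_list [computable_intros]:
  assumes "computable A" "computable (\<lambda>p. F (fst p) (fst (snd p)) (snd (snd p)))" "computable L"
  shows "computable (\<lambda>x. case L x of [] \<Rightarrow> A x | y # ys \<Rightarrow> F x y ys)"
  by (rule computable_case_code[OF assms]) (auto split: list.splits)

lemma computable_case_option [computable_intros]:
  assumes "computable A" "computable (\<lambda>p. F (fst p) (snd p))" "computable L"
  shows "computable (\<lambda>x. case L x of None \<Rightarrow> A x | Some y \<Rightarrow> F x y)"
  by (rule computable_case_code[OF assms]) (auto split: option.splits)

lemma computable_if [computable_intros]:
  assumes "computable P" "computable A" "computable B"
  shows "computable (\<lambda>x. if P x then A x else B x)"
  \<comment> \<open>The code of \<open>True\<close> is \<open>Suc 0\<close>; its argument is a dummy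
    number, hence the type \<open>nat\<close>.\<close>
  by (rule computable_case_code[of B "\<lambda>p :: _ \<times> nat. A (fst p)" P])
    (auto intro!: assms computable_comp[OF assms(2)] computable_intros split: if_splits)

lemma computable_not [computable_intros]: "computable P \<Longrightarrow> computable (\<lambda>x. \<not> P x)"
  using computable_if[OF _ computable_const computable_const, of P False True]
  by (rule back_subst[of computable]) auto

lemma computable_conj [computable_intros]:
  "computable P \<Longrightarrow> computable Q \<Longrightarrow> computable (\<lambda>x. P x \<and> Q x)"
  using computable_if[OF _ _ computable_const, of P Q False]
  by (rule back_subst[of computable]) auto

lemma computable_disj [computable_intros]:
  "computable P \<Longrightarrow> computable Q \<Longrightarrow> computable (\<lambda>x. P x \<or> Q x)"
  using computable_if[OF _ computable_const, of P Q True]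
  by (rule back_subst[of computable]) auto

text \<open>Coding is injective, so equality can be tested on codes: two numbers agree iff both
  truncated differences vanish.\<close>

lemma computable_eq [computable_intros]:
  fixes f g :: "'a::encodable \<Rightarrow> 'b::encodable"
  assumes "computable f" "computable g"
  shows "computable (\<lambda>x. f x = g x)"
proof -
  obtain t where t: "\<And>x. enc (f x) = t (enc x)" 
      "\<And>n F. rec_total n F \<Longrightarrow> rec_total n (\<lambda>xs. t (F xs))"
    using computableD[OF assms(1)] by blast
  obtain u where u: "\<And>x. enc (g x) = u (enc x)"
      "\<And>n F. rec_total n F \<Longrightarrow> rec_total n (\<lambda>xs. u (F xs))"
    using computableD[OF assms(2)] by blast
  have "rec_total 1 (\<lambda>xs. if (t (hd xs) - u (hd xs)) + (u (hd xs) - t (hd xs)) = 0 then 1 else 0)"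
    by (intro rec_total_if0 rec_total_add rec_total_diff t u rec_total_hd1 rec_total_const)
  then show ?thesis
  proof (rule computableI)
    fix x
    show "enc (f x = g x) = (if (t (hd [enc x]) - u (hd [enc x])) + (u (hd [enc x]) - t (hd [enc x])) = 0 then 1 else 0)"
      unfolding list.sel using enc_eq_iff[of "f x" "g x"]
      by (auto simp add: t u simp del: enc_eq_iff)
  qed
qed

lemma computable_rec_nat [computable_intros]:
  fixes A :: "'a::encodable \<Rightarrow> 'b::encodable"
  assumes "computable A" "computable (\<lambda>p. F (fst p) (fst (snd p)) (snd (snd p)))" "computable N"
  shows "computable (\<lambda>x. rec_nat (A x) (F x) (N x))"
proof -
  obtain t where t: "\<And>x. enc (A x) = t (enc x)" 
      "\<And>n F. rec_total n F \<Longrightarrow> rec_total n (\<lambda>xs. t (F xs))"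
    using computableD[OF assms(1)] by blast
  obtain u where u: "\<And>p. enc (F (fst p) (fst (snd p)) (snd (snd p))) = u (enc p)"
      "\<And>n F. rec_total n F \<Longrightarrow> rec_total n (\<lambda>xs. u (F xs))"
    using computableD[OF assms(2)] by blast
  obtain v where v: "\<And>x. enc (N x) = v (enc x)"
      "\<And>n F. rec_total n F \<Longrightarrow> rec_total n (\<lambda>xs. v (F xs))"
    using computableD[OF assms(3)] by blast
  have u': "u (prod_encode (enc x, prod_encode (m, enc r))) = enc (F x m r)" for x m r
    using u(1)[of "(x, m, r)"] by simp
  have "rec_total 3 (\<lambda>xs. u (prod_encode (xs ! 2, prod_encode (xs ! 0, xs ! 1))))"
    by (intro u(2) rec_total_prod_encode rec_total_proj) auto
  then have "rec_total 1 (\<lambda>xs. rec_nat (t (hd xs))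
      (\<lambda>m r. u (prod_encode (hd xs, prod_encode (m, r)))) (v (hd xs)))"
    by (intro rec_total_rec_nat[OF t(2)[OF rec_total_hd1] _ v(2)[OF rec_total_hd1]])
      (auto simp: numeral_3_eq_3 numeral_2_eq_2 length_Suc_conv)
  then show ?thesis
  proof (rule computableI)
    fix x
    \<comment> \<open>The recursion on codes follows the recursion on data step by step.\<close>
    have "enc (rec_nat (A x) (F x) n) = rec_nat (t (enc x)) (\<lambda>m r. u (prod_encode (enc x, prod_encode (m, r)))) n"
      for n
    proof (induction n)
      case (Suc n)
      show ?case using u'[of x n] by (simp add: Suc[symmetric])
    qed (simp add: t)
    then show "enc (rec_nat (A x) (F x) (N x)) = rec_nat (t (hd [enc x]))
      (\<lambda>m r. u (prod_encode (hd [enc x], prod_encode (m, r)))) (v (hd [enc x]))"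
      by (simp flip: v)
  qed
qed

section \<open>Folds and list operations\<close>

lemma length_le_enc: "length xs \<le> enc (xs :: 'a::encodable list)"
proof (induction xs)
  case (Cons x xs)
  then show ?case using le_prod_encode_2[of "enc xs" "enc x"] by simp
qed simp

text \<open>A fold iterates a step on pairs of remaining list and accumulator. The code of the list
  is a computable number of rounds that is at least its length; once the list is exhausted, the
  state no longer changes.\<close>

lemma computable_foldl [computable_intros]:
  assumes F: "computable (\<lambda>p. F (fst p) (fst (snd p)) (snd (snd p)))"
    and A: "computable A" and L: "computable L"
  shows "computable (\<lambda>x. foldl (F x) (A x) (L x))"
proof -
  define st where "st = (\<lambda>x (m::nat) q. case fst q of [] \<Rightarrow> q | y # ys \<Rightarrow> (ys, F x (snd q) y))"
  note F' = computable_comp3[OF F]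
  have "computable (\<lambda>x. snd (rec_nat (L x, A x) (st x) (enc (L x))))"
    unfolding st_def by (intro computable_intros F' A L)
  moreover have "snd (rec_nat (xs, a) (st x) n) = foldl (F x) a xs" if "length xs \<le> n" for x xs a n
  proof -
    have "rec_nat (xs, a) (st x) n = (drop n xs, foldl (F x) a (take n xs))" for n
    proof (induction n)
      case (Suc n)
      show ?case
      proof (cases "n < length xs")
        case True
        then show ?thesis using Suc by (simp add: st_def take_Suc_conv_app_nth Cons_nth_drop_Suc[symmetric])
      next
        case False
        then show ?thesis using Suc by (simp add: st_def)
      qed
    qed simp
    with that show ?thesis by simp
  qed
  ultimately show ?thesis by (simp add: length_le_enc)
qed

lemma computable_rev [computable_intros]:
  assumes "computable L" shows "computable (\<lambda>x. rev (L x))"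
proof -
  have "foldl (\<lambda>ys y. y # ys) zs xs = rev xs @ zs" for xs zs :: "'b list"
    by (induction xs arbitrary: zs) auto
  moreover have "computable (\<lambda>x. foldl (\<lambda>ys y. y # ys) [] (L x))"
    by (intro computable_intros assms)
  ultimately show ?thesis by simp
qed

lemma computable_foldr [computable_intros]:
  assumes "computable (\<lambda>p. F (fst p) (fst (snd p)) (snd (snd p)))" "computable A" "computable L"
  shows "computable (\<lambda>x. foldr (F x) (L x) (A x))"
proof -
  note F = computable_comp3[OF assms(1)]
  have "computable (\<lambda>x. foldl (\<lambda>a y. F x y a) (A x) (rev (L x)))"
    by (intro computable_intros F assms)
  then show ?thesis by (simp add: foldr_conv_foldl)
qed

lemma computable_append [computable_intros]:
  assumes "computable f" "computable g" shows "computable (\<lambda>x. f x @ g x)"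
proof -
  have "computable (\<lambda>x. foldr (#) (f x) (g x))"
    by (intro computable_intros assms)
  moreover have "foldr (#) xs ys = xs @ ys" for xs ys :: "'b list"
    by (induction xs) auto
  ultimately show ?thesis by simp
qed


lemma computable_list_all [computable_intros]:
  assumes "computable (\<lambda>p. P (fst p) (snd p))" "computable L"
  shows "computable (\<lambda>x. list_all (P x) (L x))"
proof -
  note P = computable_comp2[OF assms(1)]
  have "computable (\<lambda>x. foldr (\<lambda>y b. P x y \<and> b) (L x) True)"
    by (intro computable_intros P assms)
  moreover have "foldr (\<lambda>y b. P x y \<and> b) xs True = list_all (P x) xs" for x xs
    by (induction xs) auto
  ultimately show ?thesis by simp
qed

lemma computable_list_ex [computable_intros]:
  assumes "computable (\<lambda>p. P (fst p) (snd p))" "computable L"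
  shows "computable (\<lambda>x. list_ex (P x) (L x))"
proof -
  have "computable (\<lambda>x. \<not> list_all (\<lambda>y. \<not> P x y) (L x))"
    by (intro computable_intros assms)
  moreover have "list_ex (P x) xs \<longleftrightarrow> \<not> list_all (\<lambda>y. \<not> P x y) xs" for x xs
    by (simp add: list_ex_iff list_all_iff)
  ultimately show ?thesis by simp
qed

lemma computable_mem [computable_intros]:
  assumes "computable f" "computable L"
  shows "computable (\<lambda>x. f x \<in> set (L x))"
proof -
  have "computable (\<lambda>x. list_ex (\<lambda>y. f x = y) (L x))"
    by (intro computable_intros assms computable_comp[OF assms(1)])
  then show ?thesis by (simp add: list_ex_iff)
qed

lemma computable_map [computable_intros]:
  assumes "computable (\<lambda>p. F (fst p) (snd p))" "computable L"
  shows "computable (\<lambda>x. map (F x) (L x))"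
proof -
  note F = computable_comp2[OF assms(1)]
  have "computable (\<lambda>x. foldr (\<lambda>y ys. F x y # ys) (L x) [])"
    by (intro computable_intros F assms)
  moreover have "foldr (\<lambda>y ys. F x y # ys) xs [] = map (F x) xs" for x xs
    by (induction xs) auto
  ultimately show ?thesis by simp
qed

lemma computable_filter [computable_intros]:
  assumes "computable (\<lambda>p. P (fst p) (snd p))" "computable L"
  shows "computable (\<lambda>x. filter (P x) (L x))"
proof -
  note P = computable_comp2[OF assms(1)]
  have "computable (\<lambda>x. foldr (\<lambda>y ys. if P x y then y # ys else ys) (L x) [])"
    by (intro computable_intros P assms)
  moreover have "foldr (\<lambda>y ys. if P x y then y # ys else ys) xs [] = filter (P x) xs" for x xs
    by (induction xs) auto
  ultimately show ?thesis by simp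
qed

lemma computable_length [computable_intros]:
  assumes "computable L" shows "computable (\<lambda>x. length (L x))"
proof -
  have "computable (\<lambda>x. foldr (\<lambda>_. Suc) (L x) 0)"
    by (intro computable_intros assms)
  moreover have "foldr (\<lambda>_. Suc) xs 0 = length xs" for xs :: "'b list"
    by (induction xs) auto
  ultimately show ?thesis by simp
qed

lemma computable_upt [computable_intros]:
  assumes "computable f" shows "computable (\<lambda>x. [0..<f x])"
proof -
  have "computable (\<lambda>x. rec_nat [] (\<lambda>m ms. ms @ [m]) (f x))"
    by (intro computable_intros assms)
  moreover have "rec_nat [] (\<lambda>m ms. ms @ [m]) n = [0..<n]" for n
    by (induction n) auto
  ultimately show ?thesis by simp
qed

lemma computable_drop [computable_intros]:
  assumes "computable f" "computable L" shows "computable (\<lambda>x. drop (f x) (L x))"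
proof -
  have "computable (\<lambda>x. rec_nat (L x) (\<lambda>m ys. case ys of [] \<Rightarrow> [] | z # zs \<Rightarrow> zs) (f x))"
    by (intro computable_intros assms)
  moreover have "rec_nat xs (\<lambda>m ys. case ys of [] \<Rightarrow> [] | z # zs \<Rightarrow> zs) n = drop n xs"
    for n and xs :: "'b list"
  proof (induction n)
    case (Suc n)
    have "drop (Suc n) xs = tl (drop n xs)" by (simp add: drop_Suc tl_drop)
    with Suc show ?case by (cases "drop n xs") auto
  qed simp
  ultimately show ?thesis by simp
qed

lemma computable_take [computable_intros]:
  assumes "computable f" "computable L" shows "computable (\<lambda>x. take (f x) (L x))"
proof -
  have "computable (\<lambda>x. rec_nat [] (\<lambda>m ys. case drop m (L x) of [] \<Rightarrow> ys | z # zs \<Rightarrow> ys @ [z]) (f x))"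
    by (intro computable_intros computable_comp[OF assms(2)] assms)
  moreover have "rec_nat [] (\<lambda>m ys. case drop m xs of [] \<Rightarrow> ys | z # zs \<Rightarrow> ys @ [z]) n = take n xs"
    for n and xs :: "'b list"
  proof (induction n)
    case (Suc n)
    then show ?case
      by (cases "n < length xs") (auto simp: take_Suc_conv_app_nth Cons_nth_drop_Suc[symmetric])
  qed simp
  ultimately show ?thesis by simp
qed

section \<open>Evaluation with bounded fuel\<close>

fun evf :: "recf \<Rightarrow> nat \<Rightarrow> nat list \<Rightarrow> nat option" where
  "evf Z t xs = Some 0"
| "evf S t xs = (case xs of [] \<Rightarrow> None | x # ys \<Rightarrow> Some (Suc x))"
| "evf (Id n) t xs = (case drop n xs of [] \<Rightarrow> None | y # ys \<Rightarrow> Some y)"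
| "evf (Cn f gs) t xs =
    (if None \<in> set (map (\<lambda>g. evf g t xs) gs) then None
     else evf f t (map (\<lambda>z. case z of None \<Rightarrow> 0 | Some y \<Rightarrow> y) (map (\<lambda>g. evf g t xs) gs)))"
| "evf (Pr f g) t xs = (case xs of [] \<Rightarrow> None | n # ys \<Rightarrow>
    rec_nat (evf f t ys) (\<lambda>m r. case r of None \<Rightarrow> None | Some z \<Rightarrow> evf g t (m # z # ys)) n)"
| "evf (Mn f) t xs =
    (case filter (\<lambda>z. evf f t (z # xs) = None \<or> evf f t (z # xs) = Some 0) [0..<t] of
       [] \<Rightarrow> None
     | z # zs \<Rightarrow> if evf f t (z # xs) = Some 0 then Some z else None)"

lemma filter_upt_eq_Cons:
  "(\<exists>zs. filter P [0..<t] = z # zs) \<longleftrightarrow> z < t \<and> P z \<and> (\<forall>w<z. \<not> P w)"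
proof (induction t)
  case (Suc t)
  have "(\<exists>zs. filter P [0..<t] @ ys = z # zs) \<longleftrightarrow>
    (\<exists>zs. filter P [0..<t] = z # zs) \<or> filter P [0..<t] = [] \<and> (\<exists>zs. ys = z # zs)" for ys
    by (cases "filter P [0..<t]") auto
  moreover have "filter P [0..<t] = [] \<longleftrightarrow> (\<forall>w<t. \<not> P w)"
    by (auto simp: filter_empty_conv)
  ultimately show ?case using Suc by (auto simp: less_Suc_eq)
qed simp

text \<open>This and the next two characterisations mirror the shape of the evaluation rules, so
  that fuelled and unfuelled evaluation can be compared clause by clause.\<close>

lemma evf_Mn_eq_Some:
  "evf (Mn f) t xs = Some z \<longleftrightarrow>
    z < t \<and> evf f t (z # xs) = Some 0 \<and> (\<forall>w<z. \<exists>v. evf f t (w # xs) = Some v \<and> v \<noteq> 0)"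
proof -
  let ?P = "\<lambda>z. evf f t (z # xs) = None \<or> evf f t (z # xs) = Some 0"
  have "evf (Mn f) t xs = Some z \<longleftrightarrow> (\<exists>zs. filter ?P [0..<t] = z # zs) \<and> evf f t (z # xs) = Some 0"
    unfolding evf.simps(6) by (cases "filter ?P [0..<t]") (simp_all only: list.case option.simps, auto)
  also have "\<dots> \<longleftrightarrow>
    z < t \<and> evf f t (z # xs) = Some 0 \<and> (\<forall>w<z. \<exists>v. evf f t (w # xs) = Some v \<and> v \<noteq> 0)"
    unfolding filter_upt_eq_Cons by (metis not_None_eq option.inject)
  finally show ?thesis .
qed

lemma evf_Cn_eq_Some:
  "evf (Cn f gs) t xs = Some y \<longleftrightarrow>
    (\<exists>zs. list_all2 (\<lambda>g z. evf g t xs = Some z) gs zs \<and> evf f t zs = Some y)"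
proof -
  have "list_all2 (\<lambda>g z. evf g t xs = Some z) gs zs \<longleftrightarrow>
    None \<notin> set (map (\<lambda>g. evf g t xs) gs) \<and>
    zs = map (\<lambda>z. case z of None \<Rightarrow> 0 | Some y \<Rightarrow> y) (map (\<lambda>g. evf g t xs) gs)" for zs
  proof (induction gs arbitrary: zs)
    case (Cons g gs)
    then show ?case by (cases zs; cases "evf g t xs") auto
  qed auto
  then show ?thesis by auto
qed

lemma evf_Pr_Suc_eq_Some:
  "evf (Pr f g) t (Suc n # xs) = Some y \<longleftrightarrow>
    (\<exists>z. evf (Pr f g) t (n # xs) = Some z \<and> evf g t (n # z # xs) = Some y)"
  by (auto split: option.splits)

declare evf.simps(4-6) [simp del]

lemma evf_Pr_0: "evf (Pr f g) t (0 # xs) = evf f t xs"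
  and evf_Pr_Nil: "evf (Pr f g) t [] = None"
  by (simp_all add: evf.simps(5))

text \<open>More fuel only lengthens the search interval of \<open>Mn\<close>; values that exist
  persist, so the first zero remains the first.\<close>

lemma evf_mono: "evf f t xs = Some y \<Longrightarrow> t \<le> t' \<Longrightarrow> evf f t' xs = Some y"
proof (induction f arbitrary: xs y)
  case (Cn f gs)
  then obtain zs where zs: "list_all2 (\<lambda>g z. evf g t xs = Some z) gs zs" "evf f t zs = Some y"
    by (auto simp: evf_Cn_eq_Some)
  from zs(1) have "list_all2 (\<lambda>g z. evf g t' xs = Some z) gs zs"
    by (rule list.rel_mono_strong) (use Cn in auto)
  then show ?case using Cn zs by (auto simp: evf_Cn_eq_Some)
next
  case (Pr f g)
  show ?case
  proof (cases xs)
    case (Cons n ys)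
    have "evf (Pr f g) t (n # ys) = Some y \<Longrightarrow> evf (Pr f g) t' (n # ys) = Some y"
      using Pr.IH Pr.prems(2)
      by (induction n arbitrary: y) (auto simp: evf_Pr_0 evf_Pr_Suc_eq_Some)
    with Pr.prems Cons show ?thesis by simp
  qed (use Pr.prems in \<open>simp add: evf_Pr_Nil\<close>)
next
  case (Mn f)
  then show ?case unfolding evf_Mn_eq_Some by (metis less_le_trans)
qed auto

lemma evf_sound: "evf f t xs = Some y \<Longrightarrow> eval f xs y"
proof (induction f arbitrary: xs y)
  case (Cn f gs)
  then obtain zs where zs: "list_all2 (\<lambda>g z. evf g t xs = Some z) gs zs" "evf f t zs = Some y"
    by (auto simp: evf_Cn_eq_Some)
  from zs(1) have "list_all2 (\<lambda>g z. eval g xs z) gs zs"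
    by (rule list.rel_mono_strong) (use Cn in auto)
  then show ?case using Cn zs by (auto simp: eval_Cn_iff)
next
  case (Pr f g)
  show ?case
  proof (cases xs)
    case (Cons n ys)
    have "evf (Pr f g) t (n # ys) = Some y \<Longrightarrow> eval (Pr f g) (n # ys) y"
    proof (induction n arbitrary: y)
      case 0
      then show ?case by (simp add: evf_Pr_0 eval_Pr_0_iff Pr.IH)
    next
      case (Suc n)
      then show ?case unfolding evf_Pr_Suc_eq_Some eval_Pr_Suc_iff using Pr.IH(2) by blast
    qed
    with Pr.prems Cons show ?thesis by simp
  qed (use Pr.prems in \<open>simp add: evf_Pr_Nil\<close>)
next
  case (Mn f)
  then show ?case unfolding evf_Mn_eq_Some eval_Mn_iff by meson
next
  case (Id n)
  show ?case
  proof (cases "n < length xs")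
    case True
    with Id show ?thesis by (simp add: eval_Id_iff flip: Cons_nth_drop_Suc[OF True])
  qed (use Id in simp)
qed (auto simp: eval_Z_iff eval_S_iff split: list.splits)

text \<open>Finitely many fuel bounds are made uniform by taking maxima.\<close>

lemma list_all2_ex_bound:
  fixes P :: "nat \<Rightarrow> 'a \<Rightarrow> 'b \<Rightarrow> bool"
  assumes "list_all2 (\<lambda>x y. \<exists>t. P t x y) xs ys" and "\<And>t t' x y. P t x y \<Longrightarrow> t \<le> t' \<Longrightarrow> P t' x y"
  shows "\<exists>t. list_all2 (P t) xs ys"
  using assms(1)
proof (induction rule: list_all2_induct)
  case (Cons x xs y ys)
  then obtain t t' where t: "P t x y" "list_all2 (P t') xs ys" by auto
  have "P (max t t') x y" using t(1) by (rule assms(2)) simp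
  moreover have "list_all2 (P (max t t')) xs ys"
    using t(2) by (rule list_all2_mono) (erule assms(2), simp)
  ultimately show ?case by auto
qed simp

lemma evf_complete: "eval f xs y \<Longrightarrow> \<exists>t. evf f t xs = Some y"
proof (induction rule: eval.induct)
  case (eval_Id n xs)
  then show ?case by (simp flip: Cons_nth_drop_Suc[OF eval_Id])
next
  case (eval_Cn xs gs zs f y)
  have "list_all2 (\<lambda>g z. \<exists>t. evf g t xs = Some z) gs zs"
    using eval_Cn(1) by (rule list_all2_mono) auto
  from list_all2_ex_bound[OF this] obtain t where t: "list_all2 (\<lambda>g z. evf g t xs = Some z) gs zs"
    using evf_mono by blast
  obtain t' where t': "evf f t' zs = Some y" using eval_Cn by auto
  have "list_all2 (\<lambda>g z. evf g (max t t') xs = Some z) gs zs"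
    using t by (rule list_all2_mono) (erule evf_mono, simp)
  moreover have "evf f (max t t') zs = Some y" using t' by (rule evf_mono) simp
  ultimately show ?case by (auto simp: evf_Cn_eq_Some)
next
  case (eval_Pr0 f xs y g)
  then show ?case by (simp add: evf_Pr_0)
next
  case (eval_PrS f g n xs z y)
  then obtain t t' where t: "evf (Pr f g) t (n # xs) = Some z" "evf g t' (n # z # xs) = Some y" by auto
  have "evf (Pr f g) (max t t') (n # xs) = Some z" using t(1) by (rule evf_mono) simp
  moreover have "evf g (max t t') (n # z # xs) = Some y" using t(2) by (rule evf_mono) simp
  ultimately have "evf (Pr f g) (max t t') (n # xs) = Some z \<and> evf g (max t t') (n # z # xs) = Some y" ..
  then show ?case unfolding evf_Pr_Suc_eq_Some by blast
next
  case (eval_Mn f z xs)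
  from eval_Mn(2) obtain t where t: "evf f t (z # xs) = Some 0" ..
  \<comment> \<open>One amount of fuel must serve all \<open>w < z\<close>; it is built up one
    \<open>w\<close> at a time.\<close>
  have "\<exists>t. \<forall>w<k. \<exists>v. evf f t (w # xs) = Some v \<and> v \<noteq> 0" if "k \<le> z" for k
    using that
  proof (induction k)
    case (Suc k)
    from Suc.IH[OF Suc_leD[OF Suc.prems]]
    obtain t where t: "\<forall>w<k. \<exists>v. evf f t (w # xs) = Some v \<and> v \<noteq> 0" ..
    obtain t' v where t': "evf f t' (k # xs) = Some v" "v \<noteq> 0" using eval_Mn(3) Suc.prems Suc_le_lessD by blast
    have "\<exists>v. evf f (max t t') (w # xs) = Some v \<and> v \<noteq> 0" if "w < Suc k" for w
    proof (cases "w = k")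
      case True
      have "evf f (max t t') (k # xs) = Some v" using t'(1) by (rule evf_mono) simp
      with t'(2) True show ?thesis by blast
    next
      case False
      with that have "w < k" by simp
      with t obtain v where v: "evf f t (w # xs) = Some v" "v \<noteq> 0" by blast
      have "evf f (max t t') (w # xs) = Some v" using v(1) by (rule evf_mono) simp
      with v(2) show ?thesis by blast
    qed
    then show ?case by blast
  qed simp
  then obtain t' where t': "\<forall>w<z. \<exists>v. evf f t' (w # xs) = Some v \<and> v \<noteq> 0" by blast
  \<comment> \<open>\<open>u\<close> must also exceed \<open>z\<close>, because the search with fuel
    \<open>u\<close> inspects only numbers below \<open>u\<close>.\<close>
  define u where "u = max (Suc z) (max t t')"
  have u: "t \<le> u" "t' \<le> u" "z < u" by (auto simp: u_def)
  have "\<exists>v. evf f u (w # xs) = Some v \<and> v \<noteq> 0" if "w < z" for w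
    using t' that evf_mono[OF _ u(2)] by blast
  with evf_mono[OF t u(1)] u(3) have "evf (Mn f) u xs = Some z" unfolding evf_Mn_eq_Some by blast
  then show ?case by blast
qed auto

text \<open>The program is fixed and only fuel and arguments vary, so induction over
  \<open>f\<close> suffices and programs need no codes.\<close>

lemma computable_evf:
  assumes "computable a" "computable b"
  shows "computable (\<lambda>x. evf f (a x) (b x))"
proof -
  have "computable (\<lambda>p. evf f (fst p) (snd p))"
  proof (induction f)
    case (Cn f gs)
    \<comment> \<open>\<open>gs\<close> is part of the fixed program, so the list of values is
      assembled by induction on \<open>gs\<close>.\<close>
    from Cn(2) have gs: "computable (\<lambda>p. map (\<lambda>g. evf g (fst p) (snd p)) gs)"
      by (induction gs) (simp_all add: computable_intros)
    show ?case unfolding evf.simps by (intro computable_intros computable_comp2[OF Cn(1)] gs)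
  next
    case (Pr f g)
    show ?case unfolding evf.simps by (intro computable_intros computable_comp2[OF Pr(1)] computable_comp2[OF Pr(2)])
  next
    case (Mn f)
    show ?case unfolding evf.simps by (intro computable_intros computable_comp2[OF Mn(1)])
  qed (unfold evf.simps, (intro computable_intros)+)
  from computable_comp2[OF this assms] show ?thesis .
qed

section \<open>The conservative enumeration\<close>

text \<open>Lists the content, which makes inclusion decidable. The default 0 never occurs, since
  pauses are filtered out first.\<close>

definition content_list :: "nat option list \<Rightarrow> nat list" where
  "content_list \<sigma> = map (\<lambda>z. case z of None \<Rightarrow> 0 | Some x \<Rightarrow> x) (filter (\<lambda>z. z \<noteq> None) \<sigma>)"

lemma set_content_list [simp]: "set (content_list \<sigma>) = content_seq \<sigma>"
  by (force simp: content_list_def content_seq_def split: option.splits)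

definition covers :: "nat list \<Rightarrow> nat option list \<Rightarrow> bool" where
  "covers D \<sigma> \<longleftrightarrow> list_all (\<lambda>x. x \<in> set D) (content_list \<sigma>)"

lemma covers_iff [simp]: "covers D \<sigma> \<longleftrightarrow> content_seq \<sigma> \<subseteq> set D"
  by (auto simp: covers_def list_all_iff simp flip: set_content_list)

lemma content_seq_prefix: "prefix \<rho> \<sigma> \<Longrightarrow> content_seq \<rho> \<subseteq> content_seq \<sigma>"
  by (auto simp: prefix_def content_seq_def)

lemma finite_content_seq: "finite (content_seq \<sigma>)"
  unfolding set_content_list[symmetric] by (rule finite_set)

definition decode_seq :: "nat \<Rightarrow> nat option list" where
  "decode_seq n = map (\<lambda>k. case k of 0 \<Rightarrow> None | Suc x \<Rightarrow> Some x) (list_decode n)"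

text \<open>Every number codes a sequence, so a stage number can name the sequence it
  serves.\<close>

lemma enc_decode_seq [simp]: "enc (decode_seq n) = n"
proof -
  have "enc (case k of 0 \<Rightarrow> None | Suc x \<Rightarrow> Some x) = k" for k
    by (simp split: nat.split)
  then show ?thesis by (simp add: decode_seq_def enc_list_def comp_def del: enc_option_def)
qed

lemma decode_seq_enc [simp]: "decode_seq (enc \<sigma>) = \<sigma>"
  using enc_eq_iff[of "decode_seq (enc \<sigma>)" \<sigma>] by simp

lemma seq_code_eq_enc: "seq_code \<sigma> = enc \<sigma>"
proof -
  have "case_option 0 Suc = (enc :: nat option \<Rightarrow> nat)" by (rule ext) (simp split: option.split)
  then show ?thesis by (simp add: seq_code_def enc_list_def)
qed

type_synonym history = "(nat option list \<times> nat list \<times> nat list) list"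

text \<open>A history records triples of a sequence, its granted and its requested set, newest
  first, so the first match is current. Without a record both sets are the content.\<close>

definition entry :: "history \<Rightarrow> nat option list \<Rightarrow> nat list \<times> nat list" where
  "entry H \<sigma> = foldr (\<lambda>e r. if fst e = \<sigma> then snd e else r) H (content_list \<sigma>, content_list \<sigma>)"

lemma entry_Nil [simp]: "entry [] \<sigma> = (content_list \<sigma>, content_list \<sigma>)"
  and entry_Cons [simp]: "entry (e # H) \<sigma> = (if fst e = \<sigma> then snd e else entry H \<sigma>)"
  by (simp_all add: entry_def)

lemma entry_cases: "entry H \<sigma> = (content_list \<sigma>, content_list \<sigma>) \<or> (\<sigma>, entry H \<sigma>) \<in> set H"
  by (induction H) auto

definition extend :: "history \<Rightarrow> nat option list \<Rightarrow> nat list \<Rightarrow> nat list" where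
  "extend H \<sigma> D = D @ foldr (\<lambda>e ys.
     if take (length \<sigma>) (fst e) = \<sigma> \<and> covers D (fst e) then snd (snd e) @ ys else ys) H []"

text \<open>Iterates the absorption round of \<open>extend\<close>. The number of rounds is the
  length of a list holding \<open>D\<close> and all recorded requests, which bounds the size of
  every set that can arise.\<close>

definition closure :: "history \<Rightarrow> nat option list \<Rightarrow> nat list \<Rightarrow> nat list" where
  "closure H \<sigma> D = rec_nat D (\<lambda>_. extend H \<sigma>) (length (foldr (\<lambda>e ys. snd (snd e) @ ys) H D))"

lemma prefix_iff_take: "prefix \<sigma> \<tau> \<longleftrightarrow> take (length \<sigma>) \<tau> = \<sigma>"
  by (metis append_eq_conv_conj prefix_def take_is_prefix)

lemma set_extend:
  "set (extend H \<sigma> D) = set D \<union>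
    (\<Union>e\<in>{e \<in> set H. prefix \<sigma> (fst e) \<and> content_seq (fst e) \<subseteq> set D}. set (snd (snd e)))"
proof -
  have "set (foldr (\<lambda>e ys. if P e then snd (snd e) @ ys else ys) H []) =
    (\<Union>e\<in>{e \<in> set H. P e}. set (snd (snd e)))" for P
    by (induction H) auto
  then show ?thesis by (simp add: extend_def prefix_iff_take)
qed

lemma closure_least:
  assumes "set D \<subseteq> X"
    and "\<And>e. e \<in> set H \<Longrightarrow> prefix \<sigma> (fst e) \<Longrightarrow> content_seq (fst e) \<subseteq> X \<Longrightarrow> set (snd (snd e)) \<subseteq> X"
  shows "set (closure H \<sigma> D) \<subseteq> X"
proof -
  have "set (rec_nat D (\<lambda>_. extend H \<sigma>) n) \<subseteq> X" for n
  proof (induction n)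
    case (Suc n)
    then show ?case using assms(2) by (fastforce simp: set_extend)
  qed (use assms(1) in simp)
  then show ?thesis by (simp add: closure_def)
qed

text \<open>The rounds form an increasing chain inside the finite set \<open>set B\<close> that
  stays constant once two consecutive members agree. It is therefore stable after
  \<open>card (set B)\<close> rounds, and \<open>length B\<close> is at least that.\<close>

lemma closure_closed:
  shows "set D \<subseteq> set (closure H \<sigma> D)"
    and "\<And>e. e \<in> set H \<Longrightarrow> prefix \<sigma> (fst e) \<Longrightarrow> content_seq (fst e) \<subseteq> set (closure H \<sigma> D) \<Longrightarrow>
      set (snd (snd e)) \<subseteq> set (closure H \<sigma> D)"
proof -
  define f where "f n = rec_nat D (\<lambda>_. extend H \<sigma>) n" for n
  define B where "B = foldr (\<lambda>e ys. snd (snd e) @ ys) H D"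
  have f_Suc: "set (f (Suc n)) = set (f n) \<union>
    (\<Union>e\<in>{e \<in> set H. prefix \<sigma> (fst e) \<and> content_seq (fst e) \<subseteq> set (f n)}. set (snd (snd e)))" for n
    by (simp add: f_def set_extend)
  have mono: "mono (\<lambda>n. set (f n))"
    unfolding mono_iff_le_Suc f_Suc by blast
  have B: "set B = set D \<union> (\<Union>e\<in>set H. set (snd (snd e)))"
    unfolding B_def by (induction H) auto
  have bound: "set (f n) \<subseteq> set B" for n
  proof (induction n)
    case (Suc n)
    then show ?case unfolding f_Suc using B by blast
  qed (simp add: f_def B)
  have "finite (range (\<lambda>n. set (f n)))"
    by (rule finite_subset[of _ "Pow (set B)"]) (use bound in auto)
  moreover have "\<forall>n. set (f n) = set (f (Suc n)) \<longrightarrow> set (f (Suc n)) = set (f (Suc (Suc n)))"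
    unfolding f_Suc by auto
  ultimately have "set (f (card (set B))) = (\<Union>n. set (f n))"
    using bound mono by (intro finite_mono_strict_prefix_implies_finite_fixpoint
        finite_mono_remains_stable_implies_strict_prefix) auto
  moreover have "set (f (card (set B))) \<subseteq> set (f (length B))"
    by (rule monoD[OF mono card_length])
  ultimately have "set (f (Suc (length B))) \<subseteq> set (f (length B))" by blast
  moreover have eq: "closure H \<sigma> D = f (length B)"
    by (simp add: closure_def f_def B_def)
  ultimately show "set (snd (snd e)) \<subseteq> set (closure H \<sigma> D)"
    if "e \<in> set H" "prefix \<sigma> (fst e)" "content_seq (fst e) \<subseteq> set (closure H \<sigma> D)" for e
    using that unfolding eq f_Suc by blast
  have "set (f 0) \<subseteq> set (f (length B))" by (rule monoD[OF mono]) simp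
  then show "set D \<subseteq> set (closure H \<sigma> D)" by (simp add: eq) (simp add: f_def)
qed

section \<open>The construction by stages\<close>

locale approximation =
  fixes U :: "nat option list \<Rightarrow> nat \<Rightarrow> nat list"
  assumes U_mono: "s \<le> t \<Longrightarrow> set (U \<sigma> s) \<subseteq> set (U \<sigma> t)"
begin

text \<open>The first component of the stage number names the sequence served, so each sequence is
  served at arbitrarily late stages. Nothing happens if \<sigma> is frozen or its request is not yet
  enumerated.\<close>

definition step :: "nat \<Rightarrow> history \<Rightarrow> history" where
  "step s H = (let \<sigma> = decode_seq (fst (prod_decode s)); D = snd (entry H \<sigma>) in
     if list_ex (\<lambda>k. covers (snd (entry H (take k \<sigma>))) \<sigma>) [0..<length \<sigma>] \<or>
        \<not> list_all (\<lambda>x. x \<in> set (U \<sigma> s)) D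
     then H else (\<sigma>, D, closure H \<sigma> (D @ U \<sigma> s)) # H)"

definition history :: "nat \<Rightarrow> history" where
  "history s = rec_nat [] step s"

definition granted :: "nat \<Rightarrow> nat option list \<Rightarrow> nat set" where
  "granted s \<sigma> = set (fst (entry (history s) \<sigma>))"

definition requested :: "nat \<Rightarrow> nat option list \<Rightarrow> nat set" where
  "requested s \<sigma> = set (snd (entry (history s) \<sigma>))"

definition limit :: "nat option list \<Rightarrow> nat set" where
  "limit \<sigma> = (\<Union>s. set (U \<sigma> s))"

definition frozen :: "nat \<Rightarrow> nat option list \<Rightarrow> bool" where
  "frozen s \<sigma> \<longleftrightarrow> (\<exists>\<rho>. strict_prefix \<rho> \<sigma> \<and> content_seq \<sigma> \<subseteq> requested s \<rho>)"

definition acts :: "nat \<Rightarrow> nat option list \<Rightarrow> bool" where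
  "acts s \<sigma> \<longleftrightarrow> fst (prod_decode s) = enc \<sigma> \<and> \<not> frozen s \<sigma> \<and> requested s \<sigma> \<subseteq> set (U \<sigma> s)"

lemma granted_0: "granted 0 \<sigma> = content_seq \<sigma>"
  and requested_0: "requested 0 \<sigma> = content_seq \<sigma>"
  by (simp_all add: granted_def requested_def history_def)

lemma strict_prefix_iff_take: "strict_prefix \<rho> \<sigma> \<longleftrightarrow> (\<exists>k<length \<sigma>. \<rho> = take k \<sigma>)"
proof
  assume "strict_prefix \<rho> \<sigma>"
  then show "\<exists>k<length \<sigma>. \<rho> = take k \<sigma>"
    by (intro exI[of _ "length \<rho>"]) (auto simp: prefix_length_less strict_prefix_def prefix_iff_take)
next
  assume "\<exists>k<length \<sigma>. \<rho> = take k \<sigma>"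
  then show "strict_prefix \<rho> \<sigma>"
    by (metis length_take min.absorb4 nat_less_le strict_prefix_def take_is_prefix)
qed

lemma history_Suc:
  "history (Suc s) = (if \<exists>\<sigma>. acts s \<sigma> then
     (let \<sigma> = decode_seq (fst (prod_decode s)); D = snd (entry (history s) \<sigma>)
      in (\<sigma>, D, closure (history s) \<sigma> (D @ U \<sigma> s)) # history s) else history s)"
proof -
  have frozen: "list_ex (\<lambda>k. covers (snd (entry (history s) (take k \<sigma>))) \<sigma>) [0..<length \<sigma>] \<longleftrightarrow> frozen s \<sigma>" for \<sigma>
    unfolding frozen_def strict_prefix_iff_take requested_def by (simp add: list_ex_iff Bex_def) blast
  have ex: "(\<exists>\<sigma>. acts s \<sigma>) \<longleftrightarrow> acts s (decode_seq (fst (prod_decode s)))"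
    by (metis acts_def decode_seq_enc)
  have "history (Suc s) = step s (history s)" by (simp add: history_def)
  then show ?thesis unfolding ex unfolding step_def Let_def frozen
    by (auto simp: acts_def requested_def list_all_iff)
qed

text \<open>Hence a stage changes the sets of at most one sequence.\<close>

lemma acts_unique: "acts s \<sigma> \<Longrightarrow> acts s \<tau> \<Longrightarrow> \<sigma> = \<tau>"
  by (simp add: acts_def)

lemma no_action:
  assumes "\<not> acts s \<sigma>"
  shows "granted (Suc s) \<sigma> = granted s \<sigma>" "requested (Suc s) \<sigma> = requested s \<sigma>"
proof -
  have "entry (history (Suc s)) \<sigma> = entry (history s) \<sigma>"
    using assms by (auto simp: history_Suc Let_def acts_def)
  then show "granted (Suc s) \<sigma> = granted s \<sigma>" "requested (Suc s) \<sigma> = requested s \<sigma>"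
    by (simp_all add: granted_def requested_def)
qed

lemma action:
  assumes "acts s \<sigma>"
  shows "granted (Suc s) \<sigma> = requested s \<sigma>"
    and "requested (Suc s) \<sigma> =
      set (closure (history s) \<sigma> (snd (entry (history s) \<sigma>) @ U \<sigma> s))"
  using assms by (auto simp: granted_def requested_def history_Suc Let_def acts_def)

lemma requested_action_superset:
  assumes "acts s \<sigma>"
  shows "requested s \<sigma> \<union> set (U \<sigma> s) \<subseteq> requested (Suc s) \<sigma>"
  using closure_closed(1)[of "snd (entry (history s) \<sigma>) @ U \<sigma> s" "history s" \<sigma>]
  unfolding action(2)[OF assms] by (simp add: requested_def)

lemma requested_Suc: "requested s \<sigma> \<subseteq> requested (Suc s) \<sigma>"
  using requested_action_superset no_action(2) by (cases "acts s \<sigma>") auto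

lemma requested_mono: "s \<le> t \<Longrightarrow> requested s \<sigma> \<subseteq> requested t \<sigma>"
  by (rule lift_Suc_mono_le[of "\<lambda>s. requested s \<sigma>"]) (rule requested_Suc)

text \<open>Requests only grow, so superseded records stay inside the current request.\<close>

lemma history_entry_subset: "e \<in> set (history s) \<Longrightarrow> set (snd (snd e)) \<subseteq> requested s (fst e)"
proof (induction s)
  case (Suc s)
  show ?case
  proof (cases "e \<in> set (history s)")
    case True
    with Suc.IH requested_Suc show ?thesis by blast
  next
    case False
    with Suc.prems have "snd e = entry (history (Suc s)) (fst e)"
      by (auto simp: history_Suc Let_def split: if_splits)
    then show ?thesis by (simp add: requested_def)
  qed
qed (simp add: history_def)

text \<open>Closing under the records is enough, because a sequence without a record requests only
  its own content.\<close>

lemma requested_action_closed: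
  assumes "acts s \<sigma>" "prefix \<sigma> \<tau>" "content_seq \<tau> \<subseteq> requested (Suc s) \<sigma>"
  shows "requested s \<tau> \<subseteq> requested (Suc s) \<sigma>"
  using entry_cases[of "history s" \<tau>]
proof
  assume "entry (history s) \<tau> = (content_list \<tau>, content_list \<tau>)"
  with assms(3) show ?thesis by (simp add: requested_def)
next
  assume "(\<tau>, entry (history s) \<tau>) \<in> set (history s)"
  from closure_closed(2)[OF this] assms show ?thesis
    by (simp add: action(2)) (simp add: requested_def)
qed

text \<open>The closure also absorbs superseded records, but these lie inside current requests, so
  \<open>X\<close> need only be closed under the latter.\<close>

lemma requested_action_least:
  assumes "acts s \<sigma>" "requested s \<sigma> \<union> set (U \<sigma> s) \<subseteq> X"
    and "\<And>\<tau>. prefix \<sigma> \<tau> \<Longrightarrow> content_seq \<tau> \<subseteq> X \<Longrightarrow> requested s \<tau> \<subseteq> X"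
  shows "requested (Suc s) \<sigma> \<subseteq> X"
  unfolding action(2)[OF assms(1)]
proof (rule closure_least)
  show "set (snd (entry (history s) \<sigma>) @ U \<sigma> s) \<subseteq> X"
    using assms(2) by (simp add: requested_def)
qed (use assms(3) history_entry_subset in blast)

lemma granted_bounds: "content_seq \<sigma> \<subseteq> granted s \<sigma> \<and> granted s \<sigma> \<subseteq> requested s \<sigma>"
proof (induction s)
  case (Suc s)
  then show ?case
    using requested_Suc[of s \<sigma>] by (cases "acts s \<sigma>") (auto simp: action(1) no_action)
qed (simp add: granted_0 requested_0)

lemma granted_mono: "s \<le> t \<Longrightarrow> granted s \<sigma> \<subseteq> granted t \<sigma>"
proof (rule lift_Suc_mono_le[of "\<lambda>s. granted s \<sigma>"])
  show "granted s \<sigma> \<subseteq> granted (Suc s) \<sigma>" for s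
    using granted_bounds[of \<sigma> s] by (cases "acts s \<sigma>") (simp_all add: action(1) no_action)
qed

lemma not_acts_if_covered:
  "strict_prefix \<rho> \<sigma> \<Longrightarrow> content_seq \<sigma> \<subseteq> requested s \<rho> \<Longrightarrow> \<not> acts s \<sigma>"
  by (auto simp: acts_def frozen_def)

text \<open>If \<sigma> acts, the new request is closed by construction and \<tau> does not change
  at that stage. If \<sigma> does not act, \<tau> is frozen, so neither side changes.\<close>

lemma requested_closed:
  "prefix \<sigma> \<tau> \<Longrightarrow> content_seq \<tau> \<subseteq> requested s \<sigma> \<Longrightarrow> requested s \<tau> \<subseteq> requested s \<sigma>"
proof (induction s)
  case 0
  then show ?case by (simp add: requested_0)
next
  case (Suc s)
  show ?case
  proof (cases "\<sigma> = \<tau>")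
    case False
    with Suc.prems have strict: "strict_prefix \<sigma> \<tau>" by simp
    show ?thesis
    proof (cases "acts s \<sigma>")
      case True
      with False have "\<not> acts s \<tau>" using acts_unique by blast
      with True Suc.prems show ?thesis by (simp add: no_action requested_action_closed)
    next
      case False
      with Suc strict not_acts_if_covered[of \<sigma> \<tau> s] show ?thesis by (simp add: no_action)
    qed
  qed simp
qed

text \<open>If \<sigma> acts, its grant becomes its old request, which already contains the request
  of \<tau> and thus its grant. Otherwise \<tau> is covered by the request of \<sigma> and hence
  frozen.\<close>

lemma granted_closed:
  "prefix \<sigma> \<tau> \<Longrightarrow> content_seq \<tau> \<subseteq> granted s \<sigma> \<Longrightarrow> granted s \<tau> \<subseteq> granted s \<sigma>"
proof (induction s)
  case 0
  then show ?case by (simp add: granted_0)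
next
  case (Suc s)
  show ?case
  proof (cases "\<sigma> = \<tau>")
    case False
    with Suc.prems have strict: "strict_prefix \<sigma> \<tau>" by simp
    show ?thesis
    proof (cases "acts s \<sigma>")
      case True
      with False have "\<not> acts s \<tau>" using acts_unique by blast
      moreover have "requested s \<tau> \<subseteq> requested s \<sigma>"
        using Suc.prems True by (simp add: action(1) requested_closed)
      ultimately show ?thesis using True granted_bounds[of \<tau> s] by (auto simp: action(1) no_action)
    next
      case False
      with Suc.prems have "content_seq \<tau> \<subseteq> granted s \<sigma>" by (simp add: no_action)
      then have "\<not> acts s \<tau>" using strict not_acts_if_covered granted_bounds[of \<sigma> s] by blast
      with False Suc show ?thesis by (simp add: no_action)
    qed
  qed simp
qed

text \<open>A grant is either the initial one or a request that was found inside \<open>U\<close>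
  when it was granted.\<close>

lemma granted_subset: "granted s \<sigma> \<subseteq> content_seq \<sigma> \<or> granted s \<sigma> \<subseteq> limit \<sigma>"
proof (induction s)
  case (Suc s)
  then show ?case
    by (cases "acts s \<sigma>") (auto simp: action(1) no_action acts_def limit_def)
qed (simp add: granted_0)

section \<open>Conjectures as directed unions of grants\<close>

definition conjecture :: "nat option list \<Rightarrow> nat set" where
  "conjecture \<tau> = \<Union> {granted s \<rho> | s \<rho>. prefix \<rho> \<tau> \<and> content_seq \<tau> \<subseteq> granted s \<rho>}"

text \<open>Prefixes of \<tau> are comparable. At a common later stage the shorter one covers
  \<tau>, hence also the longer one, and so contains its grant.\<close>

lemma granted_directed:
  assumes "prefix \<rho> \<tau>" "content_seq \<tau> \<subseteq> granted s \<rho>" "prefix \<rho>' \<tau>" "content_seq \<tau> \<subseteq> granted s' \<rho>'"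
  shows "\<exists>\<rho>'' t. prefix \<rho>'' \<rho> \<and> prefix \<rho>'' \<rho>' \<and> content_seq \<tau> \<subseteq> granted t \<rho>'' \<and>
    granted s \<rho> \<union> granted s' \<rho>' \<subseteq> granted t \<rho>''"
proof -
  let ?t = "max s s'"
  have mono: "granted s \<rho> \<subseteq> granted ?t \<rho>" "granted s' \<rho>' \<subseteq> granted ?t \<rho>'"
    by (simp_all add: granted_mono)
  from prefix_same_cases[OF assms(1,3)] show ?thesis
  proof
    assume p: "prefix \<rho> \<rho>'"
    have "content_seq \<rho>' \<subseteq> granted ?t \<rho>"
      using content_seq_prefix[OF assms(3)] assms(2) mono by blast
    from granted_closed[OF p this] p assms mono show ?thesis
      by (intro exI[of _ \<rho>] exI[of _ ?t]) auto
  next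
    assume p: "prefix \<rho>' \<rho>"
    have "content_seq \<rho> \<subseteq> granted ?t \<rho>'"
      using content_seq_prefix[OF assms(1)] assms(4) mono by blast
    from granted_closed[OF p this] p assms mono show ?thesis
      by (intro exI[of _ \<rho>'] exI[of _ ?t]) auto
  qed
qed

text \<open>The finite content of \<tau> already lies in one grant of a prefix of \<rho>. This grant
  contributes to both conjectures, and by directedness every other contribution can be merged into
  one made by a prefix of its owner.\<close>

lemma conjecture_conservative:
  assumes "prefix \<rho> \<tau>" "content_seq \<tau> \<subseteq> conjecture \<rho>"
  shows "conjecture \<rho> = conjecture \<tau>"
proof -
  \<comment> \<open>A finite part of a directed union lies in a single member; the elements of
    \<open>F\<close> are merged one by one.\<close>
  have "\<exists>\<rho>\<^sub>0 s. prefix \<rho>\<^sub>0 \<rho> \<and> content_seq \<rho> \<subseteq> granted s \<rho>\<^sub>0 \<and> F \<subseteq> granted s \<rho>\<^sub>0"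
    if "finite F" "F \<subseteq> conjecture \<rho>" for F
    using that
  proof (induction F)
    case empty
    show ?case using granted_bounds[of \<rho> 0] by (intro exI[of _ \<rho>] exI[of _ 0]) auto
  next
    case (insert x F)
    then obtain \<rho>\<^sub>0 s where a: "prefix \<rho>\<^sub>0 \<rho>" "content_seq \<rho> \<subseteq> granted s \<rho>\<^sub>0" "F \<subseteq> granted s \<rho>\<^sub>0" by auto
    from insert.prems obtain \<rho>' s' where
      b: "prefix \<rho>' \<rho>" "content_seq \<rho> \<subseteq> granted s' \<rho>'" "x \<in> granted s' \<rho>'"
      by (auto simp: conjecture_def)
    from granted_directed[OF a(1,2) b(1,2)] obtain \<rho>'' t where
      c: "prefix \<rho>'' \<rho>\<^sub>0" "content_seq \<rho> \<subseteq> granted t \<rho>''"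
        "granted s \<rho>\<^sub>0 \<union> granted s' \<rho>' \<subseteq> granted t \<rho>''" by blast
    have "prefix \<rho>'' \<rho>" using c(1) a(1) by (rule prefix_order.trans)
    with c a(3) b(3) show ?case by blast
  qed
  from this[OF finite_content_seq assms(2)] obtain \<rho>\<^sub>0 s where
    a: "prefix \<rho>\<^sub>0 \<rho>" "content_seq \<rho> \<subseteq> granted s \<rho>\<^sub>0" "content_seq \<tau> \<subseteq> granted s \<rho>\<^sub>0" by blast
  have a': "prefix \<rho>\<^sub>0 \<tau>" using a(1) assms(1) by (rule prefix_order.trans)
  \<comment> \<open>In both directions the grant contributing \<open>x\<close> is joined with that
    of \<open>\<rho>\<^sub>0\<close>. The joint grant belongs to a prefix of
    \<open>\<rho>\<^sub>0\<close>, so it is admissible for \<rho> and for \<tau>.\<close>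
  show ?thesis
  proof (intro equalityI subsetI)
    fix x assume "x \<in> conjecture \<rho>"
    then obtain \<rho>' s' where b: "prefix \<rho>' \<rho>" "content_seq \<rho> \<subseteq> granted s' \<rho>'" "x \<in> granted s' \<rho>'"
      by (auto simp: conjecture_def)
    from granted_directed[OF a(1,2) b(1,2)] obtain \<rho>'' t where
      c: "prefix \<rho>'' \<rho>\<^sub>0" "granted s \<rho>\<^sub>0 \<union> granted s' \<rho>' \<subseteq> granted t \<rho>''" by blast
    have "prefix \<rho>'' \<tau>" using c(1) a' by (rule prefix_order.trans)
    then show "x \<in> conjecture \<tau>" unfolding conjecture_def using c(2) a(3) b(3) by blast
  next
    fix x assume "x \<in> conjecture \<tau>"
    then obtain \<rho>' s' where b: "prefix \<rho>' \<tau>" "content_seq \<tau> \<subseteq> granted s' \<rho>'" "x \<in> granted s' \<rho>'"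
      by (auto simp: conjecture_def)
    from granted_directed[OF a' a(3) b(1,2)] obtain \<rho>'' t where
      c: "prefix \<rho>'' \<rho>\<^sub>0" "granted s \<rho>\<^sub>0 \<union> granted s' \<rho>' \<subseteq> granted t \<rho>''" by blast
    have "prefix \<rho>'' \<rho>" using c(1) a(1) by (rule prefix_order.trans)
    then show "x \<in> conjecture \<rho>" unfolding conjecture_def using c(2) a(2) b(3) by blast
  qed
qed

end

section \<open>Initial segments of texts\<close>

lemma take_init_seg: "m \<le> n \<Longrightarrow> take m (init_seg T n) = init_seg T m"
  by (simp add: init_seg_def take_map)

lemma init_seg_prefix: "m \<le> n \<Longrightarrow> prefix (init_seg T m) (init_seg T n)"
  by (metis take_init_seg take_is_prefix)

lemma prefix_init_seg:
  assumes "prefix \<rho> (init_seg T n)"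
  shows "\<exists>m\<le>n. \<rho> = init_seg T m"
proof (intro exI conjI)
  show le: "length \<rho> \<le> n" using prefix_length_le[OF assms] by (simp add: init_seg_def)
  show "\<rho> = init_seg T (length \<rho>)"
    using assms unfolding prefix_iff_take take_init_seg[OF le] by simp
qed

lemma content_seq_init_seg: "content_seq (init_seg T n) = {x. \<exists>i<n. T i = Some x}"
proof -
  have "Some x \<in> T ` {0..<n} \<longleftrightarrow> (\<exists>i<n. T i = Some x)" for x
    by (simp add: image_iff Bex_def eq_commute[of "Some x"])
  then show ?thesis by (simp add: content_seq_def init_seg_def)
qed

lemma content_seq_init_seg_subset: "content_seq (init_seg T n) \<subseteq> content T"
  by (auto simp: content_seq_init_seg content_def)

lemma content_seq_init_seg_mono:
  "m \<le> n \<Longrightarrow> content_seq (init_seg T m) \<subseteq> content_seq (init_seg T n)"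
  by (rule content_seq_prefix) (rule init_seg_prefix)

lemma finite_subset_chain:
  fixes A :: "nat \<Rightarrow> 'a set"
  assumes "finite F" "F \<subseteq> (\<Union>n. A n)" "\<And>m n. m \<le> n \<Longrightarrow> A m \<subseteq> A n"
  shows "\<exists>n. F \<subseteq> A n"
  using assms(1,2)
proof (induction F)
  case (insert x F)
  from insert.prems obtain m where "x \<in> A m" by blast
  moreover have "F \<subseteq> (\<Union>n. A n)" using insert.prems by simp
  from insert.IH[OF this] obtain n where "F \<subseteq> A n" ..
  moreover have "A m \<subseteq> A (max m n)" "A n \<subseteq> A (max m n)" by (simp_all add: assms(3))
  ultimately have "insert x F \<subseteq> A (max m n)" by blast
  then show ?case by (rule exI)
next
  case empty
  show ?case by simp
qed

lemma finite_subset_init_seg: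
  assumes "finite F" "F \<subseteq> content T"
  shows "\<exists>n. F \<subseteq> content_seq (init_seg T n)"
proof (rule finite_subset_chain[OF assms(1)])
  show "F \<subseteq> (\<Union>n. content_seq (init_seg T n))"
  proof
    fix x assume "x \<in> F"
    then obtain i where "T i = Some x" using assms(2) by (auto simp: content_def)
    then have "x \<in> content_seq (init_seg T (Suc i))" by (auto simp: content_seq_init_seg)
    then show "x \<in> (\<Union>n. content_seq (init_seg T n))" by blast
  qed
qed (rule content_seq_init_seg_mono)

section \<open>Convergence on texts for a learnt language\<close>

context approximation
begin

lemma finite_requested: "finite (requested s \<sigma>)"
  by (simp add: requested_def)

text \<open>Without further action the finite request would stay constant and eventually be
  enumerated, so that \<sigma> would act when next served.\<close>

lemma acts_eventually:
  assumes "requested t \<sigma> \<subseteq> limit \<sigma>" "\<And>s. \<not> frozen s \<sigma>"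
  shows "\<exists>t'\<ge>t. acts t' \<sigma>"
proof (rule ccontr)
  assume *: "\<not> (\<exists>t'\<ge>t. acts t' \<sigma>)"
  have const: "requested t' \<sigma> = requested t \<sigma>" if "t \<le> t'" for t'
    using that by (induction rule: dec_induct) (use * no_action in auto)
  obtain u where u: "requested t \<sigma> \<subseteq> set (U \<sigma> u)"
    using finite_subset_chain[OF finite_requested, of t \<sigma> "\<lambda>s. set (U \<sigma> s)"] assms(1) U_mono
    unfolding limit_def by blast
  \<comment> \<open>A pair is coded by a number no smaller than its second component, so this stage
    serves \<sigma> and comes after both \<open>t\<close> and \<open>u\<close>.\<close>
  define t' where "t' = prod_encode (enc \<sigma>, max t u)"
  have "max t u \<le> t'" unfolding t'_def by (rule le_prod_encode_2)
  then have "t \<le> t'" "u \<le> t'" by auto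
  with u U_mono[of u t' \<sigma>] const[of t'] have "requested t' \<sigma> \<subseteq> set (U \<sigma> t')" by auto
  then have "acts t' \<sigma>" using assms(2) by (simp add: acts_def t'_def)
  with * \<open>t \<le> t'\<close> show False by blast
qed

text \<open>\<open>cons\<close> and \<open>over\<close> speak of arbitrary sequences with content in
  \<open>L\<close>, because requests are absorbed from extensions that need not be initial segments
  of \<open>T\<close>.\<close>

lemma conjecture_converges:
  assumes cons: "\<And>\<sigma> \<tau>. prefix \<sigma> \<tau> \<Longrightarrow> content_seq \<tau> \<subseteq> L \<Longrightarrow> content_seq \<tau> \<subseteq> limit \<sigma> \<Longrightarrow>
      limit \<tau> = limit \<sigma>"
    and over: "\<And>\<sigma>. content_seq \<sigma> \<subseteq> L \<Longrightarrow> L \<subseteq> limit \<sigma> \<Longrightarrow> limit \<sigma> = L"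
    and conv: "\<exists>n\<^sub>0. \<forall>n\<ge>n\<^sub>0. limit (init_seg T n) = L"
    and T: "content T = L"
  shows "\<exists>n\<^sub>0. \<forall>n\<ge>n\<^sub>0. conjecture (init_seg T n) = L"
proof -
  note sub = content_seq_init_seg_subset[of T, unfolded T]
  note cmono = content_seq_init_seg_mono[of _ _ T]
  show ?thesis
  proof (cases "finite L")
    case True
    then obtain n\<^sub>0 where n\<^sub>0: "L \<subseteq> content_seq (init_seg T n\<^sub>0)"
      using finite_subset_init_seg[of L T] T by auto
    have "conjecture (init_seg T n) = L" if "n \<ge> n\<^sub>0" for n
    proof -
      have c: "content_seq (init_seg T n) = L" using sub[of n] cmono[OF that] n\<^sub>0 by blast
      \<comment> \<open>A grant containing \<open>L\<close> lies within the content of \<rho>, which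
        is inside \<open>L\<close>, or within the limit of \<rho>, which then equals
        \<open>L\<close> by \<open>over\<close>.\<close>
      have "granted s \<rho> = L" if "prefix \<rho> (init_seg T n)" "L \<subseteq> granted s \<rho>" for s \<rho>
      proof -
        have "content_seq \<rho> \<subseteq> L" using content_seq_prefix[OF that(1)] c by simp
        with over[of \<rho>] granted_subset[of s \<rho>] that(2) show ?thesis by blast
      qed
      moreover have "granted 0 (init_seg T n) = L" by (simp add: granted_0 c)
      ultimately show ?thesis unfolding conjecture_def c by blast
    qed
    then show ?thesis by blast
  next
    case False
    define bad where "bad m \<longleftrightarrow> \<not> L \<subseteq> limit (init_seg T m)" for m
    from conv obtain n\<^sub>0 where n\<^sub>0: "\<And>n. n \<ge> n\<^sub>0 \<Longrightarrow> limit (init_seg T n) = L" by blast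
    have good: "limit (init_seg T m) = L" if "\<not> bad m" for m
      using that over[OF sub] unfolding bad_def by blast
    \<comment> \<open>A grant lies in the limit, missing \<open>x\<close>, or in the content,
      missing \<open>y\<close>, so it never holds both. Such a \<open>y\<close> exists because
      \<open>L\<close> is infinite.\<close>
    have bad_granted: "\<exists>k. \<forall>n\<ge>k. \<forall>s. \<not> content_seq (init_seg T n) \<subseteq> granted s (init_seg T m)"
      if m: "bad m" for m
    proof -
      obtain x where x: "x \<in> L" "x \<notin> limit (init_seg T m)" using m unfolding bad_def by blast
      obtain y where y: "y \<in> L" "y \<notin> content_seq (init_seg T m)"
        using False finite_subset[OF _ finite_content_seq[of "init_seg T m"], of L] by blast
      obtain k where "{x, y} \<subseteq> content_seq (init_seg T k)"
        using finite_subset_init_seg[of "{x, y}" T] x y T by auto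
      then have "\<not> content_seq (init_seg T n) \<subseteq> granted s (init_seg T m)" if "n \<ge> k" for n s
        using x y granted_subset[of s "init_seg T m"] cmono[OF that] by blast
      then show ?thesis by blast
    qed
    have bad_requested: "\<exists>k. \<forall>n\<ge>k. \<forall>s. \<not> content_seq (init_seg T n) \<subseteq> requested s (init_seg T m)"
      if m: "bad m" for m
    proof -
      obtain k where k: "\<And>n s. n \<ge> k \<Longrightarrow> \<not> content_seq (init_seg T n) \<subseteq> granted s (init_seg T m)"
        using bad_granted[OF m] by blast
      show ?thesis
      proof (cases "\<exists>n\<ge>k. \<exists>s. content_seq (init_seg T n) \<subseteq> requested s (init_seg T m)")
        case True
        then obtain n s where ns: "n \<ge> k" "content_seq (init_seg T n) \<subseteq> requested s (init_seg T m)"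
          by blast
        \<comment> \<open>Acting again would grant a request that covers the late content, against
          \<open>bad_granted\<close>. So the request is stuck at a finite set, which the infinite
          \<open>L\<close> leaves.\<close>
        have const: "requested t (init_seg T m) = requested s (init_seg T m)" if "s \<le> t" for t
          using that
        proof (induction rule: dec_induct)
          case (step t)
          have "\<not> acts t (init_seg T m)"
            using k[OF ns(1), of "Suc t"] ns(2) step.IH by (auto simp: action(1))
          with step.IH show ?case by (simp add: no_action)
        qed simp
        have le: "requested t (init_seg T m) \<subseteq> requested s (init_seg T m)" for t
          using const[of t] requested_mono[of t s] by (cases "s \<le> t") auto
        obtain x where x: "x \<in> L" "x \<notin> requested s (init_seg T m)"
          using False finite_subset[OF _ finite_requested[of s "init_seg T m"], of L] by blast
        obtain k' where "{x} \<subseteq> content_seq (init_seg T k')"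
          using finite_subset_init_seg[of "{x}" T] x T by auto
        then have "\<not> content_seq (init_seg T n) \<subseteq> requested t (init_seg T m)" if "n \<ge> k'" for n t
          using x le[of t] cmono[OF that] by blast
        then show ?thesis by blast
      qed blast
    qed
    then obtain k where k: "\<And>m n s. bad m \<Longrightarrow> n \<ge> k m \<Longrightarrow>
        \<not> content_seq (init_seg T n) \<subseteq> requested s (init_seg T m)"
      by metis
    \<comment> \<open>Only indices below \<open>n\<^sub>0\<close> can be bad; the sum is an upper
      bound for all their thresholds.\<close>
    define K where "K = max n\<^sub>0 (\<Sum>m<n\<^sub>0. k m)"
    have K: "\<not> content_seq (init_seg T n) \<subseteq> requested s (init_seg T m)" if "bad m" "n \<ge> K" for m n s
    proof -
      have "m < n\<^sub>0" using that(1) n\<^sub>0[of m] unfolding bad_def by fastforce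
      then have "k m \<le> (\<Sum>m<n\<^sub>0. k m)" by (intro member_le_sum) auto
      with that k show ?thesis unfolding K_def by simp
    qed
    have "conjecture (init_seg T n) = L" if n: "n \<ge> K" for n
    proof (intro equalityI subsetI)
      fix x assume "x \<in> conjecture (init_seg T n)"
      then obtain \<rho> s where \<rho>: "prefix \<rho> (init_seg T n)"
          "content_seq (init_seg T n) \<subseteq> granted s \<rho>" "x \<in> granted s \<rho>"
        by (auto simp: conjecture_def)
      from prefix_init_seg[OF \<rho>(1)] obtain m where m: "\<rho> = init_seg T m" by blast
      have "\<not> bad m" using K[of m n s] n \<rho>(2) granted_bounds[of \<rho> s] m by blast
      with good m granted_subset[of s \<rho>] sub[of m] \<rho>(3) show "x \<in> L" by blast
    next
      fix x assume x: "x \<in> L"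
      let ?P = "\<lambda>m. \<exists>s. content_seq (init_seg T n) \<subseteq> requested s (init_seg T m)"
      \<comment> \<open>The shortest initial segment whose request ever covers the current content.
        By the choice of \<open>K\<close> it is not bad.\<close>
      define m where "m = (LEAST m. ?P m)"
      have Pn: "?P n" using granted_bounds[of "init_seg T n" 0] by blast
      then have "m \<le> n" unfolding m_def by (rule Least_le)
      have least: "\<not> ?P m'" if "m' < m" for m'
        using that unfolding m_def by (rule not_less_Least)
      from LeastI[of ?P, OF Pn] obtain s where s: "content_seq (init_seg T n) \<subseteq> requested s (init_seg T m)"
        unfolding m_def by blast
      define \<sigma> where "\<sigma> = init_seg T m"
      have lim: "limit \<sigma> = L" using good K[of m n s] n s unfolding \<sigma>_def by blast
      have not_frozen: "\<not> frozen t \<sigma>" for t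
      proof
        assume "frozen t \<sigma>"
        then obtain \<rho> where \<rho>: "strict_prefix \<rho> \<sigma>" "content_seq \<sigma> \<subseteq> requested t \<rho>"
          unfolding frozen_def by blast
        then obtain m' where m': "m' \<le> m" "\<rho> = init_seg T m'"
          using prefix_init_seg[of \<rho> T m] strict_prefix_def unfolding \<sigma>_def by blast
        with \<rho>(1) have "m' < m" unfolding \<sigma>_def by (metis le_neq_implies_less prefix_order.less_irrefl)
        \<comment> \<open>A shorter prefix covering \<sigma> would absorb the request of \<sigma>
          and so cover the content of \<open>init_seg T n\<close>, against minimality.\<close>
        have "content_seq \<sigma> \<subseteq> requested (max s t) \<rho>"
          using \<rho>(2) requested_mono[of t "max s t" \<rho>] by auto
        then have "requested (max s t) \<sigma> \<subseteq> requested (max s t) \<rho>"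
          using \<rho>(1) by (intro requested_closed) auto
        with s requested_mono[of s "max s t" \<sigma>]
        have "content_seq (init_seg T n) \<subseteq> requested (max s t) \<rho>" unfolding \<sigma>_def by auto
        with least[OF \<open>m' < m\<close>] m'(2) show False by blast
      qed
      \<comment> \<open>The induction runs over all extensions of \<sigma> at once, since an action
        of \<tau> absorbs requests of further extensions. Each has limit \<open>L\<close> by
        \<open>cons\<close>, so its enumeration contributes nothing outside
        \<open>L\<close>.\<close>
      have req: "requested t \<tau> \<subseteq> L" if "prefix \<sigma> \<tau>" "content_seq \<tau> \<subseteq> L" for t \<tau>
        using that
      proof (induction t arbitrary: \<tau>)
        case (Suc t)
        show ?case
        proof (cases "acts t \<tau>")
          case True
          have "limit \<tau> = L" using cons[OF Suc.prems] Suc.prems(2) lim by simp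
          then have "set (U \<tau> t) \<subseteq> L" by (auto simp: limit_def)
          with Suc.IH[OF Suc.prems] True show ?thesis
            by (intro requested_action_least)
              (auto intro: Suc.IH[THEN subsetD] prefix_order.trans[OF Suc.prems(1)])
        next
          case False
          with Suc show ?thesis by (simp add: no_action)
        qed
      qed (simp add: requested_0)
      have acts: "\<exists>t'\<ge>t. acts t' \<sigma>" for t
        using acts_eventually[OF _ not_frozen, of t] req[of \<sigma> t] sub[of m] lim
        unfolding \<sigma>_def by simp
      obtain u where u: "x \<in> set (U \<sigma> u)" using x lim unfolding limit_def by blast
      \<comment> \<open>Two actions are used: the first puts \<open>x\<close> into the request, the
        second grants that request.\<close>
      obtain t\<^sub>1 where t\<^sub>1: "t\<^sub>1 \<ge> max u s" "acts t\<^sub>1 \<sigma>" using acts by blast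
      obtain t\<^sub>2 where t\<^sub>2: "t\<^sub>2 \<ge> Suc t\<^sub>1" "acts t\<^sub>2 \<sigma>" using acts by blast
      have "x \<in> requested (Suc t\<^sub>1) \<sigma>"
        using u U_mono[of u t\<^sub>1 \<sigma>] t\<^sub>1 requested_action_superset[OF t\<^sub>1(2)] by auto
      then have "x \<in> requested t\<^sub>2 \<sigma>" using requested_mono[OF t\<^sub>2(1)] by blast
      moreover have "content_seq (init_seg T n) \<subseteq> requested t\<^sub>2 \<sigma>"
        using s requested_mono[of s t\<^sub>2 \<sigma>] t\<^sub>1 t\<^sub>2 unfolding \<sigma>_def by auto
      ultimately show "x \<in> conjecture (init_seg T n)"
        unfolding conjecture_def action(1)[OF t\<^sub>2(2), symmetric]
        using init_seg_prefix[OF \<open>m \<le> n\<close>, of T] unfolding \<sigma>_def[symmetric] by blast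
    qed
    then show ?thesis by blast
  qed
qed

end

section \<open>Computability of the enumeration\<close>

text \<open>Decoding is the identity on codes; the same holds for \<open>prod_decode\<close>
  below.\<close>

lemma computable_decode_seq [computable_intros]:
  assumes "computable f"
  shows "computable (\<lambda>x. decode_seq (f x))"
proof -
  have "computable decode_seq"
    by (rule computableI[OF rec_total_hd1]) (simp only: enc_decode_seq enc_nat_def list.sel)
  from computable_comp[OF this assms] show ?thesis .
qed

lemma computable_prod_decode [computable_intros]:
  assumes "computable f"
  shows "computable (\<lambda>x. prod_decode (f x))"
proof -
  have "computable prod_decode"
    by (rule computableI[OF rec_total_hd1]) simp
  from computable_comp[OF this assms] show ?thesis .
qed

lemma computable_content_list [computable_intros]:
  "computable f \<Longrightarrow> computable (\<lambda>x. content_list (f x))"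
  unfolding content_list_def by (intro computable_intros)

lemma computable_covers [computable_intros]:
  assumes "computable f" "computable g"
  shows "computable (\<lambda>x. covers (f x) (g x))"
  unfolding covers_def by (intro computable_intros computable_comp[OF assms(1)] assms)

lemma computable_entry [computable_intros]:
  assumes "computable f" "computable g"
  shows "computable (\<lambda>x. entry (f x) (g x))"
  unfolding entry_def by (intro computable_intros computable_comp[OF assms(2)] assms)

lemma computable_extend [computable_intros]:
  assumes "computable f" "computable g" "computable h"
  shows "computable (\<lambda>x. extend (f x) (g x) (h x))"
  unfolding extend_def
  by (intro computable_intros computable_comp[OF assms(2)] computable_comp[OF assms(3)] assms)

lemma computable_closure [computable_intros]:
  assumes "computable f" "computable g" "computable h"
  shows "computable (\<lambda>x. closure (f x) (g x) (h x))"
  unfolding closure_def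
  by (intro computable_intros computable_comp[OF assms(1)] computable_comp[OF assms(2)] assms)

lemma (in approximation) computable_history:
  assumes "computable (\<lambda>p. U (fst p) (snd p))"
  shows "computable history"
  unfolding history_def step_def Let_def
  by (intro computable_intros computable_comp2[OF assms])

lemma pcomp2_search:
  assumes "computable (\<lambda>p. P (fst p) (fst (snd p)) (snd (snd p)))"
  shows "\<exists>\<theta>. pcomp2 \<theta> \<and> (\<forall>c x. \<theta> c x \<noteq> None \<longleftrightarrow> (\<exists>s :: nat. P (c :: nat) (x :: nat) s))"
proof -
  from computableD[OF computable_if[OF assms computable_const[of 0] computable_const[of "Suc 0"]]]
  obtain t where
    t: "\<forall>p. enc (if P (fst p) (fst (snd p)) (snd (snd p)) then 0 else Suc 0) = t (enc p)"
    and t_rec: "\<And>n F. rec_total n F \<Longrightarrow> rec_total n (\<lambda>xs. t (F xs))"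
    by blast
  \<comment> \<open>\<open>Mn\<close> prepends the searched variable, so \<open>s\<close> comes
    first. It looks for a zero, so 0 stands for truth.\<close>
  have "rec_total 3 (\<lambda>xs. t (prod_encode (xs ! 1, prod_encode (xs ! 2, xs ! 0))))"
    by (intro t_rec rec_total_prod_encode rec_total_proj) auto
  then obtain g where g: "\<And>xs y. length xs = 3 \<Longrightarrow>
      eval g xs y \<longleftrightarrow> y = t (prod_encode (xs ! 1, prod_encode (xs ! 2, xs ! 0)))"
    unfolding rec_total_def by blast
  have eval_g: "eval g [s, c, x] y \<longleftrightarrow> y = (if P c x s then 0 else Suc 0)" for s c x y
    using t[rule_format, of "(c, x, s)"] by (simp add: g)
  \<comment> \<open>The least witness is returned so that \<theta> agrees with \<open>Mn g\<close>
    in value, not only in domain.\<close>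
  define \<theta> where "\<theta> c x = (if \<exists>s. P c x s then Some (LEAST s. P c x s) else None)" for c x
  have "\<theta> c x = Some y \<longleftrightarrow> eval (Mn g) [c, x] y" for c x y
  proof -
    have "eval (Mn g) [c, x] y \<longleftrightarrow> P c x y \<and> (\<forall>w<y. \<not> P c x w)"
      by (auto simp: eval_Mn_iff eval_g)
    also have "\<dots> \<longleftrightarrow> \<theta> c x = Some y"
    proof
      assume *: "P c x y \<and> (\<forall>w<y. \<not> P c x w)"
      then have "(LEAST s. P c x s) = y" by (intro Least_equality) (auto simp: not_less[symmetric])
      with * show "\<theta> c x = Some y" by (auto simp: \<theta>_def)
    next
      assume "\<theta> c x = Some y"
      then have *: "\<exists>s. P c x s" "y = (LEAST s. P c x s)"
        by (auto simp: \<theta>_def split: if_splits)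
      show "P c x y \<and> (\<forall>w<y. \<not> P c x w)"
        unfolding *(2) using LeastI_ex[OF *(1)] not_less_Least[of _ "P c x"] by blast
    qed
    finally show ?thesis ..
  qed
  then have "pcomp2 \<theta>" unfolding pcomp2_def by blast
  moreover have "\<theta> c x \<noteq> None \<longleftrightarrow> (\<exists>s. P c x s)" for c x by (simp add: \<theta>_def)
  ultimately show ?thesis by blast
qed

lemma (in approximation) conjecture_semidecidable:
  assumes "computable (\<lambda>p. U (fst p) (snd p))"
  shows "\<exists>\<theta>. pcomp2 \<theta> \<and> (\<forall>\<tau> x. \<theta> (enc \<tau>) x \<noteq> None \<longleftrightarrow> x \<in> conjecture \<tau>)"
proof -
  \<comment> \<open>At a fixed stage only finitely many prefixes are inspected, so membership is a
    search over \<open>s\<close>. The bound is a successor because the sequence counts as its own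
    prefix.\<close>
  define P where "P c x s \<longleftrightarrow> list_ex (\<lambda>k.
      covers (fst (entry (history s) (take k (decode_seq c)))) (decode_seq c) \<and>
      x \<in> set (fst (entry (history s) (take k (decode_seq c))))) [0..<Suc (length (decode_seq c))]"
    for c x :: nat and s
  have "computable (\<lambda>p. P (fst p) (fst (snd p)) (snd (snd p)))"
    unfolding P_def
    by (intro computable_intros computable_comp[OF computable_history[OF assms]])
  from pcomp2_search[OF this] obtain \<theta> where
    \<theta>: "pcomp2 \<theta>" "\<And>c x. \<theta> c x \<noteq> None \<longleftrightarrow> (\<exists>s. P c x s)" by blast
  have "(\<exists>s. P (enc \<tau>) x s) \<longleftrightarrow> x \<in> conjecture \<tau>" for \<tau> x
  proof -
    have P: "P (enc \<tau>) x s \<longleftrightarrow>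
        (\<exists>k\<le>length \<tau>. content_seq \<tau> \<subseteq> granted s (take k \<tau>) \<and> x \<in> granted s (take k \<tau>))" for s
      unfolding P_def decode_seq_enc list_ex_iff covers_iff granted_def
      by (simp add: less_Suc_eq_le Bex_def del: upt_Suc)
    show ?thesis
    proof
      assume "\<exists>s. P (enc \<tau>) x s"
      then show "x \<in> conjecture \<tau>" unfolding P conjecture_def using take_is_prefix by blast
    next
      assume "x \<in> conjecture \<tau>"
      then obtain s \<rho> where *: "prefix \<rho> \<tau>" "content_seq \<tau> \<subseteq> granted s \<rho>" "x \<in> granted s \<rho>"
        by (auto simp: conjecture_def)
      have "P (enc \<tau>) x s" unfolding P
        using * prefix_length_le[OF *(1)] by (intro exI[of _ "length \<rho>"]) (simp add: prefix_iff_take)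
      then show "\<exists>s. P (enc \<tau>) x s" ..
    qed
  qed
  with \<theta> show ?thesis by (intro exI[of _ \<theta>]) simp
qed

section \<open>Equality of the learning criteria\<close>

text \<open>Where \<open>h\<close> is undefined the set is empty, so that it exists for every
  sequence although the learner is partial.\<close>

definition hypothesis_set :: "(nat \<Rightarrow> nat \<Rightarrow> nat option) \<Rightarrow> (nat \<Rightarrow> nat option) \<Rightarrow> nat option list \<Rightarrow> nat set"
  where "hypothesis_set \<phi> h \<sigma> = {x. \<exists>e. h (enc \<sigma>) = Some e \<and> x \<in> W \<phi> e}"

lemma hypothesis_set_approximation:
  assumes "pcomp1 h" "pcomp2 \<phi>"
  shows "\<exists>U. computable (\<lambda>p. U (fst p) (snd p)) \<and> approximation U \<and>
    (\<forall>\<sigma>. approximation.limit U \<sigma> = hypothesis_set \<phi> h \<sigma>)"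
proof -
  obtain fh where fh: "\<And>x y. h x = Some y \<longleftrightarrow> eval fh [x] y"
    using assms(1) unfolding pcomp1_def by blast
  obtain f\<phi> where f\<phi>: "\<And>x y z. \<phi> x y = Some z \<longleftrightarrow> eval f\<phi> [x, y] z"
    using assms(2) unfolding pcomp2_def by blast
  \<comment> \<open>Applies \<phi> to the index that \<open>h\<close> outputs; for fixed
    \<open>c\<close> the domain in \<open>x\<close> is the hypothesis.\<close>
  define g where "g = Cn f\<phi> [Cn fh [Id 0], Id 1]"
  have g: "eval g [c, x] y \<longleftrightarrow> (\<exists>e. h c = Some e \<and> \<phi> e x = Some y)" for c x y
    by (auto simp: g_def eval_Cn_iff eval_Id_iff list_all2_Cons1 fh f\<phi>)
  define U where "U \<sigma> s = filter (\<lambda>x. evf g s [enc \<sigma>, x] \<noteq> None) [0..<s]" for \<sigma> :: "nat option list" and s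
  have "computable (\<lambda>p. U (fst p) (snd p))"
    unfolding U_def by (intro computable_intros computable_evf)
  moreover have U: "approximation U"
    by standard (auto simp: U_def intro: evf_mono)
  moreover have "approximation.limit U \<sigma> = hypothesis_set \<phi> h \<sigma>" for \<sigma>
  proof -
    have "(\<exists>s. x \<in> set (U \<sigma> s)) \<longleftrightarrow> (\<exists>y. eval g [enc \<sigma>, x] y)" for x
    proof
      assume "\<exists>s. x \<in> set (U \<sigma> s)"
      then show "\<exists>y. eval g [enc \<sigma>, x] y" by (auto simp: U_def dest: evf_sound)
    next
      assume "\<exists>y. eval g [enc \<sigma>, x] y"
      then obtain y t where t: "evf g t [enc \<sigma>, x] = Some y" using evf_complete by blast
      \<comment> \<open>The stage must exceed \<open>x\<close> as well, since \<open>U\<close> lists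
        only numbers below the stage.\<close>
      have "evf g (max t (Suc x)) [enc \<sigma>, x] = Some y" using t by (rule evf_mono) simp
      then have "x \<in> set (U \<sigma> (max t (Suc x)))" by (simp add: U_def)
      then show "\<exists>s. x \<in> set (U \<sigma> s)" ..
    qed
    moreover have "(\<exists>y. eval g [enc \<sigma>, x] y) \<longleftrightarrow> x \<in> hypothesis_set \<phi> h \<sigma>" for x
      by (auto simp: hypothesis_set_def W_def g)
    ultimately show ?thesis by (intro set_eqI) (simp add: approximation.limit_def[OF U])
  qed
  ultimately show ?thesis by blast
qed

text \<open>After \<tau>, position \<open>length \<tau> + x\<close> shows \<open>x\<close> if it
  belongs to \<open>L\<close> and a pause otherwise; this also serves empty and finite
  \<open>L\<close>.\<close>

lemma extend_to_text:
  assumes "content_seq \<tau> \<subseteq> L"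
  obtains T where "content T = L" "init_seg T (length \<tau>) = \<tau>"
proof
  define T where "T i = (if i < length \<tau> then \<tau> ! i else
    if i - length \<tau> \<in> L then Some (i - length \<tau>) else None)" for i
  show "init_seg T (length \<tau>) = \<tau>"
    by (intro nth_equalityI) (auto simp: init_seg_def T_def)
  show "content T = L"
  proof (intro equalityI subsetI)
    fix x assume "x \<in> content T"
    then obtain i where "T i = Some x" by (auto simp: content_def)
    then have "Some x \<in> set \<tau> \<or> x \<in> L"
      by (metis T_def nth_mem option.distinct(1) option.inject)
    then show "x \<in> L" using assms by (auto simp: content_seq_def)
  next
    fix x assume "x \<in> L"
    then have "T (length \<tau> + x) = Some x" by (simp add: T_def)
    then show "x \<in> content T" by (auto simp: content_def)
  qed
qed

lemma G_total_hypothesis_set: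
  "G_total h T \<Longrightarrow> W \<phi> (Gp h T n) = hypothesis_set \<phi> h (init_seg T n)"
  by (force simp: G_total_def Gp_def G_def hypothesis_set_def seq_code_eq_enc)

text \<open>Transfers the criterion from texts to sequences: each sequence with content in
  \<open>L\<close> begins some text for \<open>L\<close>. An overgeneralising hypothesis covers all
  later content of this text, so it equals the final hypothesis, which is \<open>L\<close>.\<close>

lemma learns_SemConv_Bc_properties:
  assumes "learns_SemConv_Bc \<phi> h \<L>" "L \<in> \<L>"
  defines "w \<equiv> hypothesis_set \<phi> h"
  shows "\<And>\<sigma> \<tau>. prefix \<sigma> \<tau> \<Longrightarrow> content_seq \<tau> \<subseteq> L \<Longrightarrow> content_seq \<tau> \<subseteq> w \<sigma> \<Longrightarrow> w \<tau> = w \<sigma>"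
    and "\<And>\<sigma>. content_seq \<sigma> \<subseteq> L \<Longrightarrow> L \<subseteq> w \<sigma> \<Longrightarrow> w \<sigma> = L"
    and "\<And>T. content T = L \<Longrightarrow> \<exists>n\<^sub>0. \<forall>n\<ge>n\<^sub>0. w (init_seg T n) = L"
proof -
  have bc: "\<exists>n\<^sub>0. \<forall>n\<ge>n\<^sub>0. w (init_seg T n) = L"
    and sc: "n < m \<Longrightarrow> content_seq (init_seg T m) \<subseteq> w (init_seg T n) \<Longrightarrow>
      w (init_seg T n) = w (init_seg T m)" if T: "content T = L" for T n m
  proof -
    have *: "G_total h T" "SemConv \<phi> (Gp h T) T" "Bc \<phi> (Gp h T) T"
      using assms(1,2) T unfolding learns_SemConv_Bc_def by blast+
    note w = G_total_hypothesis_set[OF *(1), of \<phi>, folded w_def]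
    show "\<exists>n\<^sub>0. \<forall>n\<ge>n\<^sub>0. w (init_seg T n) = L"
      using *(3) unfolding Bc_def w T .
    show "w (init_seg T n) = w (init_seg T m)"
      if "n < m" "content_seq (init_seg T m) \<subseteq> w (init_seg T n)"
      using *(2) that unfolding SemConv_def w by blast
  qed
  show "\<exists>n\<^sub>0. \<forall>n\<ge>n\<^sub>0. w (init_seg T n) = L" if "content T = L" for T
    using bc[OF that] .
  show "w \<tau> = w \<sigma>" if st: "prefix \<sigma> \<tau>" "content_seq \<tau> \<subseteq> L" "content_seq \<tau> \<subseteq> w \<sigma>" for \<sigma> \<tau>
  proof (cases "\<sigma> = \<tau>")
    case False
    with st(1) have len: "length \<sigma> < length \<tau>" by (simp add: prefix_length_less strict_prefix_def)
    obtain T where T: "content T = L" "init_seg T (length \<tau>) = \<tau>"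
      using extend_to_text[OF st(2)] .
    have "init_seg T (length \<sigma>) = \<sigma>"
      using take_init_seg[of "length \<sigma>" "length \<tau>" T] T(2) st(1) len by (simp add: prefix_iff_take)
    with sc[OF T(1) len] T(2) st(3) show ?thesis by simp
  qed simp
  show "w \<sigma> = L" if s: "content_seq \<sigma> \<subseteq> L" "L \<subseteq> w \<sigma>" for \<sigma>
  proof -
    obtain T where T: "content T = L" "init_seg T (length \<sigma>) = \<sigma>"
      using extend_to_text[OF s(1)] .
    obtain n\<^sub>0 where n\<^sub>0: "\<And>n. n \<ge> n\<^sub>0 \<Longrightarrow> w (init_seg T n) = L" using bc[OF T(1)] by blast
    \<comment> \<open>The successor makes the position strictly later than \<sigma>, as
      \<open>SemConv\<close> compares distinct positions.\<close>
    let ?m = "max n\<^sub>0 (Suc (length \<sigma>))"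
    have "content_seq (init_seg T ?m) \<subseteq> w (init_seg T (length \<sigma>))"
      using content_seq_init_seg_subset[of T ?m] T s(2) by simp
    from sc[OF T(1) _ this] n\<^sub>0[of ?m] T(2) show ?thesis by simp
  qed
qed

theorem theorem12:
  fixes \<phi> :: "nat \<Rightarrow> nat \<Rightarrow> nat option"
  assumes "acceptable \<phi>"
  shows "TauSemConvTxtGBc \<phi> = TxtGSemConvBc \<phi>"
proof (intro equalityI subsetI)
  fix \<L> assume "\<L> \<in> TauSemConvTxtGBc \<phi>"
  then show "\<L> \<in> TxtGSemConvBc \<phi>"
    unfolding TauSemConvTxtGBc_def TxtGSemConvBc_def learns_tauSemConv_Bc_def learns_SemConv_Bc_def
    by blast
next
  fix \<L> assume "\<L> \<in> TxtGSemConvBc \<phi>"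
  then obtain h where h: "pcomp1 h" "learns_SemConv_Bc \<phi> h \<L>"
    unfolding TxtGSemConvBc_def by blast
  have "pcomp2 \<phi>" using assms unfolding acceptable_def by blast
  from hypothesis_set_approximation[OF h(1) this] obtain U where
    U: "computable (\<lambda>p. U (fst p) (snd p))" "approximation U"
      "\<And>\<sigma>. approximation.limit U \<sigma> = hypothesis_set \<phi> h \<sigma>" by blast
  interpret approximation U by (rule U(2))
  obtain \<theta> where \<theta>: "pcomp2 \<theta>" "\<And>\<tau> x. \<theta> (enc \<tau>) x \<noteq> None \<longleftrightarrow> x \<in> conjecture \<tau>"
    using conjecture_semidecidable[OF U(1)] by blast
  \<comment> \<open>Acceptability turns the code of a sequence effectively into a \<phi>-index of
    its conjecture; this translation is the new learner, and it is total.\<close>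
  obtain t where t: "total_comp t" "\<And>e. \<theta> e = \<phi> (t e)"
    using assms \<theta>(1) unfolding acceptable_def by blast
  define h' where "h' c = Some (t c)" for c
  have "pcomp1 h'" using t(1) unfolding total_comp_def h'_def .
  have W_h': "W \<phi> (Gp h' T n) = conjecture (init_seg T n)" for T n
    using \<theta>(2) by (auto simp: W_def Gp_def G_def h'_def seq_code_eq_enc t(2)[symmetric])
  have "G_total h' T" for T by (simp add: G_total_def G_def h'_def)
  moreover have "SemConv \<phi> (Gp h' T) T" for T
    unfolding SemConv_def W_h' by (auto intro!: conjecture_conservative init_seg_prefix)
  moreover have "Bc \<phi> (Gp h' T) T" if "L \<in> \<L>" "content T = L" for L T
    unfolding Bc_def W_h' that(2)
    by (rule conjecture_converges)
      (use learns_SemConv_Bc_properties[OF h(2) that(1)] that(2) in \<open>auto simp: U(3)\<close>)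
  ultimately have "learns_tauSemConv_Bc \<phi> h' \<L>" unfolding learns_tauSemConv_Bc_def by blast
  with \<open>pcomp1 h'\<close> show "\<L> \<in> TauSemConvTxtGBc \<phi>" unfolding TauSemConvTxtGBc_def by blast
qed

end
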